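(* Let $(u^{(i)})_{i\ge0}$, $(V^{(i)})_{i\ge0}$ be generated by the policy iteration: given $u^{(0)}:\mathbb{R}^d\to U$, for $i=0,1,2,\dots$ the function $V^{(i)}\in C^1(\mathbb{R}^d)$ solves $$\nabla V^{(i)}(x)^t\big(f(x)+g(x)u^{(i)}(x)\big)+\ell(x)+\|u^{(i)}(x)\|_R^2=0,\qquad V^{(i)}(0)=0,$$ and $$u^{(i+1)}(x)=\mathcal{P}_U\big(-\tfrac12R^{-1}g(x)^t\nabla V^{(i)}(x)\big).$$ If $u^{(0)}\in\mathcal{A}(\Omega)$, then $u^{(i)}\in\mathcal{A}(\Omega)$ for all $i$. Moreover, $V(x)\le V^{(i+1)}(x)\le V^{(i)}(x)$ for all $x\in\Omega$ and all $i$, where $V$ is the optimal value function. Further, $\{V^{(i)}(x)\}$ converges from above pointwise to some $\bar V(x)\ge V(x)$ in $\Omega$.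
   Context: Setting. $\Omega\subset\mathbb{R}^d$ is a domain containing the origin in its interior. $U\subset\mathbb{R}^m$ is a closed convex set containing $0$, $R\in\mathbb{R}^{m\times m}$ is a (symmetric) positive definite matrix, and $\|u\|_R^2=u^tRu$. The functions $f:\mathbb{R}^d\to\mathbb{R}^d$, $g:\mathbb{R}^d\to\mathbb{R}^{d\times m}$ and $\ell:\mathbb{R}^d\to\mathbb{R}$ are Lipschitz continuous, $f(0)=0$, $\ell(0)=0$, $\ell(y)>0$ for $y\neq0$, and $g$ is globally bounded on $\mathbb{R}^d$. Control problem. For $x\in\mathbb{R}^d$, minimize over controls $u(\cdot)\in\mathcal{U}=\{u:\mathbb{R}_+\to U\}$ the cost $$\mathcal{J}(x,u(\cdot))=\int_0^\infty\big(\ell(y(t))+\|u(t)\|_R^2\big)\,dt\quad\text{subject to}\quad \dot y(t)=f(y(t))+g(y(t))u(t),\ y(0)=x.$$ The optimal value function is $V(x)=\min_{u(\cdot)\in\mathcal{U}}\mathcal{J}(x,u(\cdot))$. Standing assumptions: for every $x\in\Omega$ the minimization problem has a solution (in particular there is a control $u\in L^2(0,\infty;\mathbb{R}^m)$ with state $y\in W^{1,2}(0,\infty;\mathbb{R}^d)$); $V\in C^1(\mathbb{R}^d)$ and $V$ is radially unbounded, i.e. $V(x)\to\infty$ as $\|x\|\to\infty$. Consequently $V$ satisfies the Hamilton-Jacobi-Bellman equation $\inf_{u\in U}\{\nabla V(x)^t(f(x)+g(x)u)+\ell(x)+\|u\|_R^2\}=0$, $V(0)=0$, and an optimal control in feedback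 form is the minimizer $u^*(x)=\mathcal{P}_U(-\tfrac12R^{-1}g(x)^t\nabla V(x))$. $\mathcal{P}_U$ denotes the orthogonal projection of $\mathbb{R}^m$ onto $U$ with respect to the $R$-weighted inner product $(a,b)_R=a^tRb$. For a feedback $u:\mathbb{R}^d\to U$, $y(t;u)$ denotes the solution of $\dot y=f(y)+g(y)u(y)$, $y(0)=x$. Admissible controls. A measurable function $u:\mathbb{R}^d\to U$ is admissible with respect to $\Omega$, written $u\in\mathcal{A}(\Omega)$, if (i) $u$ is continuous on $\mathbb{R}^d$; (ii) $u(0)=0$; (iii) $\lim_{t\to\infty}y(t;u)=0$ for all $x\in\Omega$; (iv) $\int_0^\infty(\ell(y(t;u))+\|u(y(t;u))\|_R^2)\,dt<\infty$ for all $x\in\Omega$. It is part of the setting that the linear equation for $V^{(i)}$ has a solution $V^{(i)}\in C^1(\mathbb{R}^d)$ at each step, so that the iteration is defined for all $i$. *)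

theory Defs
  imports "HOL-Analysis.Analysis"
begin

definition sym_pos_def :: "real^'m^'m \<Rightarrow> bool" where
  "sym_pos_def R \<longleftrightarrow> transpose R = R \<and> (\<forall>u. u \<noteq> 0 \<longrightarrow> 0 < u \<bullet> (R *v u))"

definition wnorm_sq :: "real^'m^'m \<Rightarrow> real^'m \<Rightarrow> real" where
  "wnorm_sq R u = u \<bullet> (R *v u)"

text \<open>Unlike \<^const>\<open>closest_point\<close>, distances are measured in the \<open>R\<close>-weighted norm.\<close>

definition wproj :: "real^'m^'m \<Rightarrow> (real^'m) set \<Rightarrow> real^'m \<Rightarrow> real^'m" where
  "wproj R U z = (THE p. p \<in> U \<and> (\<forall>q\<in>U. wnorm_sq R (z - p) \<le> wnorm_sq R (z - q)))"

definition gradient :: "('a::real_inner \<Rightarrow> real) \<Rightarrow> 'a \<Rightarrow> 'a" where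
  "gradient W x = (THE D. GDERIV W x :> D)"

definition C1 :: "('a::real_inner \<Rightarrow> real) \<Rightarrow> bool" where
  "C1 W \<longleftrightarrow> (\<forall>x. W differentiable (at x)) \<and> continuous_on UNIV (gradient W)"

definition square_integrable :: "(real \<Rightarrow> 'a::euclidean_space) \<Rightarrow> bool" where
  "square_integrable h \<longleftrightarrow>
     h \<in> borel_measurable (lebesgue_on {0..}) \<and>
     integrable (lebesgue_on {0..}) (\<lambda>t. (norm (h t))\<^sup>2)"

text \<open>\<open>W\<^sup>1\<^sup>,\<^sup>2(0,\<infinity>)\<close>, in terms of absolutely continuous representatives on \<open>[0,\<infinity>)\<close>.\<close>

definition sobolev_12 :: "(real \<Rightarrow> 'a::euclidean_space) \<Rightarrow> bool" where
  "sobolev_12 y \<longleftrightarrow>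
     square_integrable y \<and>
     (\<exists>y'. square_integrable y' \<and> (\<forall>t\<ge>0. (y' has_integral (y t - y 0)) {0..t}))"

text \<open>An open-loop control only needs to be measurable, so the state equation is understood in the
  Caratheodory sense, i.e. as an integral equation with locally integrable integrand.\<close>

definition control_pair ::
  "(real^'d \<Rightarrow> real^'d) \<Rightarrow> (real^'d \<Rightarrow> real^'m^'d) \<Rightarrow> (real^'m) set \<Rightarrow> real^'d \<Rightarrow>
   (real \<Rightarrow> real^'m) \<Rightarrow> (real \<Rightarrow> real^'d) \<Rightarrow> bool" where
  "control_pair f g U x u y \<longleftrightarrow>
     u \<in> borel_measurable (lebesgue_on {0..}) \<and> (\<forall>t\<ge>0. u t \<in> U) \<and>
     continuous_on {0..} y \<and> y 0 = x \<and>
     (\<forall>t\<ge>0. (\<lambda>s. f (y s) + g (y s) *v u s) absolutely_integrable_on {0..t} \<and>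
            ((\<lambda>s. f (y s) + g (y s) *v u s) has_integral (y t - x)) {0..t})"

text \<open>The integrand is nonnegative in all uses, so the cost is a well-defined value in
  \<open>[0,\<infinity>]\<close>.\<close>

definition cost ::
  "(real^'d \<Rightarrow> real) \<Rightarrow> real^'m^'m \<Rightarrow> (real \<Rightarrow> real^'m) \<Rightarrow> (real \<Rightarrow> real^'d) \<Rightarrow> ennreal" where
  "cost l R u y = (\<integral>\<^sup>+ t. ennreal (l (y t) + wnorm_sq R (u t)) \<partial>lebesgue_on {0..})"

definition optimal_value ::
  "(real^'d \<Rightarrow> real^'d) \<Rightarrow> (real^'d \<Rightarrow> real^'m^'d) \<Rightarrow> (real^'d \<Rightarrow> real) \<Rightarrow> real^'m^'m \<Rightarrow>
   (real^'m) set \<Rightarrow> real^'d \<Rightarrow> ennreal" where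
  "optimal_value f g l R U x = (INF (u, y) \<in> {(u, y). control_pair f g U x u y}. cost l R u y)"

definition optimal_pair ::
  "(real^'d \<Rightarrow> real^'d) \<Rightarrow> (real^'d \<Rightarrow> real^'m^'d) \<Rightarrow> (real^'d \<Rightarrow> real) \<Rightarrow> real^'m^'m \<Rightarrow>
   (real^'m) set \<Rightarrow> real^'d \<Rightarrow> (real \<Rightarrow> real^'m) \<Rightarrow> (real \<Rightarrow> real^'d) \<Rightarrow> bool" where
  "optimal_pair f g l R U x u y \<longleftrightarrow>
     control_pair f g U x u y \<and>
     (\<forall>u' y'. control_pair f g U x u' y' \<longrightarrow> cost l R u y \<le> cost l R u' y')"

definition closed_loop ::
  "(real^'d \<Rightarrow> real^'d) \<Rightarrow> (real^'d \<Rightarrow> real^'m^'d) \<Rightarrow> (real^'d \<Rightarrow> real^'m) \<Rightarrow> real^'d \<Rightarrow>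
   real set \<Rightarrow> (real \<Rightarrow> real^'d) \<Rightarrow> bool" where
  "closed_loop f g u x I y \<longleftrightarrow>
     y 0 = x \<and>
     (\<forall>t\<in>I. (y has_vector_derivative f (y t) + g (y t) *v u (y t)) (at t within I))"

text \<open>A merely continuous feedback does not guarantee unique closed-loop trajectories. Speaking of
  ``the'' trajectory \<open>y(t;u)\<close> is therefore rendered by requiring that a global trajectory exists,
  that every local trajectory extends to a global one (no blow-up), and that the conditions on
  \<open>y(t;u)\<close> hold for every trajectory.\<close>

definition globally_solvable ::
  "(real^'d \<Rightarrow> real^'d) \<Rightarrow> (real^'d \<Rightarrow> real^'m^'d) \<Rightarrow> (real^'d \<Rightarrow> real^'m) \<Rightarrow> real^'d \<Rightarrow> bool" where
  "globally_solvable f g u x \<longleftrightarrow>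
     (\<exists>y. closed_loop f g u x {0..} y) \<and>
     (\<forall>T>0. \<forall>y. closed_loop f g u x {0..<T} y \<longrightarrow>
        (\<exists>z. closed_loop f g u x {0..} z \<and> (\<forall>t\<in>{0..<T}. z t = y t)))"

definition admissible ::
  "(real^'d \<Rightarrow> real^'d) \<Rightarrow> (real^'d \<Rightarrow> real^'m^'d) \<Rightarrow> (real^'d \<Rightarrow> real) \<Rightarrow> real^'m^'m \<Rightarrow>
   (real^'m) set \<Rightarrow> (real^'d) set \<Rightarrow> (real^'d \<Rightarrow> real^'m) set" where
  "admissible f g l R U \<Omega> = {u.
     u \<in> borel_measurable borel \<and> (\<forall>x. u x \<in> U) \<and>
     continuous_on UNIV u \<and>
     u 0 = 0 \<and>
     (\<forall>x\<in>\<Omega>. globally_solvable f g u x \<and>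
        (\<forall>y. closed_loop f g u x {0..} y \<longrightarrow>
           (y \<longlongrightarrow> 0) at_top \<and> cost l R (\<lambda>t. u (y t)) y < \<infinity>))}"

end

theory Submission
  imports Defs "HOL-Complex_Analysis.Great_Picard"
begin

text \<open>
  Write \<open>F = f + g u\<close> for a closed loop and \<open>q = l + wnorm_sq R u\<close> for its running cost. The equation for
  the policy value \<open>W\<close> says that \<open>W\<close> decreases along trajectories of \<open>F\<close> exactly at rate \<open>q\<close>. Since the
  projected control minimizes the Hamiltonian \<open>v \<mapsto> \<nabla>W \<bullet> (f + g v) + l + wnorm_sq R v\<close> over \<open>U\<close>
  (\<open>wproj_minimizes_hamiltonian\<close>), the same \<open>W\<close> decreases along trajectories of the improved closed loop at least
  at the rate of the improved running cost. So \<open>W\<close> is a candidate Lyapunov function for the improved policy. If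
  its trajectories converge to the origin, integration in time shows that the improved policy value is at most \<open>W\<close>.

  The difficulty is that a Lyapunov argument needs \<open>W\<close> to be nonnegative with bounded sublevel sets wherever the
  new trajectories go. Admissibility of the old policy controls \<open>W\<close> on \<open>\<Omega>\<close> only,
  and nothing keeps the new trajectories inside \<open>\<Omega>\<close>. The proof therefore establishes \<open>V \<le> W\<close> on the whole space
  (\<open>value_le_policy_value\<close>); as \<open>V\<close> is nonnegative and radially unbounded, \<open>W\<close> is then a global Lyapunov
  function. The inequality spreads from the origin by continuation over
  the wells of \<open>W\<close>, the components of its sublevel sets that contain the origin. Trajectories of \<open>F\<close> that start in a
  bounded well remain there and have cost at most \<open>W\<close>, so \<open>V \<le> W\<close> in that well, which confines the well to a sublevel set
  of \<open>V\<close>. Since \<open>W\<close> has no critical point besides the origin, a bounded well remains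
  bounded when its level is raised a little (\<open>bounded_well_step\<close>), and the confinement by \<open>V\<close> rules out an
  escape to infinity at a finite level. Hence bounded wells exhaust the space
  (\<open>le_W_of_le_trajectory_cost\<close>).

  Feedbacks are merely continuous, so existence of trajectories is Peano's theorem (\<open>peano_bounded\<close>), and
  all estimates are made for an arbitrary trajectory of the closed loop. Admissibility and \<open>V \<le> W\<close> then
  pass from each policy to the next, and the policy values form a decreasing sequence bounded below by \<open>V\<close>.
\<close>

section \<open>Existence of trajectories of a continuous vector field\<close>

text \<open>Abstracts \<^const>\<open>closed_loop\<close> from the control structure, so that the cut-off vector fields
  below, which need not be of the form \<open>f + g u\<close>, are covered as well.\<close>

definition trajectory :: "('a::real_normed_vector \<Rightarrow> 'a) \<Rightarrow> 'a \<Rightarrow> real set \<Rightarrow> (real \<Rightarrow> 'a) \<Rightarrow> bool" where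
  "trajectory F x I y \<longleftrightarrow> y 0 = x \<and> (\<forall>t\<in>I. (y has_vector_derivative F (y t)) (at t within I))"

lemma trajectory_continuous_on:
  fixes F :: "'a::banach \<Rightarrow> 'a"
  shows "trajectory F x I y \<Longrightarrow> continuous_on I y"
  unfolding trajectory_def by (auto intro: continuous_on_vector_derivative)

lemma trajectory_subset: "trajectory F x I y \<Longrightarrow> J \<subseteq> I \<Longrightarrow> trajectory F x J y"
  unfolding trajectory_def by (blast intro: has_vector_derivative_within_subset)

lemma trajectory_has_integral:
  fixes F :: "'a::banach \<Rightarrow> 'a"
  assumes "trajectory F x I y" "{s..t} \<subseteq> I" "s \<le> t"
  shows "((\<lambda>r. F (y r)) has_integral (y t - y s)) {s..t}"
proof (rule fundamental_theorem_of_calculus[OF assms(3)])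
  fix r assume "r \<in> {s..t}"
  then show "(y has_vector_derivative F (y r)) (at r within {s..t})"
    using trajectory_subset[OF assms(1,2)] by (simp add: trajectory_def)
qed

text \<open>The integral equation survives pointwise limits and concatenation; derivatives are recovered
  from it at the end.\<close>

lemma trajectory_of_integral_equation:
  fixes F :: "'a::banach \<Rightarrow> 'a"
  assumes F: "continuous_on UNIV F" and y: "continuous_on {0..} y"
    and eq: "\<And>t. 0 \<le> t \<Longrightarrow> y t = x + integral {0..t} (\<lambda>s. F (y s))"
  shows "trajectory F x {0..} y"
  unfolding trajectory_def
proof (intro conjI ballI)
  show "y 0 = x"
    using eq[of 0] by simp
  fix t :: real assume t: "t \<in> {0..}"
  have "continuous_on {0..t+1} (\<lambda>s. F (y s))"
    by (rule continuous_on_compose2[OF F continuous_on_subset[OF y]]) auto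
  then have "((\<lambda>u. x + integral {0..u} (\<lambda>s. F (y s))) has_vector_derivative F (y t)) (at t within {0..t+1})"
    using t by (auto intro!: derivative_eq_intros integral_has_vector_derivative)
  then have "(y has_vector_derivative F (y t)) (at t within {0..t+1})"
    by (rule has_vector_derivative_transform[rotated 2]) (use t eq in auto)
  moreover have "at t within {0..t+1} = at t within {0..}"
    by (rule at_within_nhd[of _ "{t - 1<..<t + 1}"]) auto
  ultimately show "(y has_vector_derivative F (y t)) (at t within {0..})"
    by simp
qed

lemma lipschitz_on_integral:
  fixes G :: "real \<Rightarrow> 'a::euclidean_space"
  assumes G: "continuous_on UNIV G" and M: "\<And>s. norm (G s) \<le> M"
  shows "M-lipschitz_on UNIV (\<lambda>t. x + integral {0..t} G)"
proof -
  have M0: "0 \<le> M"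
    using M[of 0] norm_ge_zero order_trans by blast
  have int: "G integrable_on {a..b}" for a b
    by (rule integrable_continuous_real) (rule continuous_on_subset[OF G], simp)
  have neg: "integral {0..t} G = integral {0..max 0 t} G" for t
    by (cases "t \<ge> 0") (auto simp: max_def)
  have le: "norm (integral {0..t} G - integral {0..s} G) \<le> M * (t - s)" if "0 \<le> s" "s \<le> t" for s t
  proof -
    have "integral {0..t} G - integral {0..s} G = integral {s..t} G"
      using Henstock_Kurzweil_Integration.integral_combine[OF that int] by (simp add: algebra_simps)
    also have "norm \<dots> \<le> M * (t - s)"
      by (rule integral_bound) (use that M in \<open>auto intro: continuous_on_subset[OF G]\<close>)
    finally show ?thesis .
  qed
  have "norm (integral {0..t} G - integral {0..s} G) \<le> M * \<bar>t - s\<bar>" if "s \<le> t" for s t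
  proof -
    have "norm (integral {0..max 0 t} G - integral {0..max 0 s} G) \<le> M * (max 0 t - max 0 s)"
      using le[of "max 0 s" "max 0 t"] that by simp
    also have "\<dots> \<le> M * \<bar>t - s\<bar>"
      using M0 that by (intro mult_left_mono) auto
    finally show ?thesis
      using neg by simp
  qed
  then have "norm (integral {0..t} G - integral {0..s} G) \<le> M * \<bar>t - s\<bar>" for s t
    by (metis abs_minus_commute linorder_le_cases norm_minus_commute)
  then show ?thesis
    using M0 by (auto intro!: lipschitz_onI simp: dist_norm)
qed

text \<open>Tonelli's approximation for Peano's theorem. With the argument delayed by \<open>h\<close>, the
  right-hand side up to time \<open>k h\<close> depends on the solution up to time \<open>(k - 1) h\<close> only; hence the
  Picard iterates are stationary up to any given time after finitely many steps.\<close>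

lemma delay_equation_solution:
  fixes F :: "'a::euclidean_space \<Rightarrow> 'a" and h T :: real
  assumes F: "continuous_on UNIV F" and M: "\<And>z. norm (F z) \<le> M" and h: "0 < h"
  obtains Z where "M-lipschitz_on UNIV Z" "Z 0 = x"
    "\<And>t. t \<le> T \<Longrightarrow> Z t = x + integral {0..t} (\<lambda>s. F (Z (s - h)))"
proof -
  define \<Phi> :: "(real \<Rightarrow> 'a) \<Rightarrow> real \<Rightarrow> 'a"
    where "\<Phi> = (\<lambda>Y t. x + integral {0..t} (\<lambda>s. F (Y (s - h))))"
  define Y :: "nat \<Rightarrow> real \<Rightarrow> 'a" where "Y = (\<lambda>k. (\<Phi> ^^ k) (\<lambda>_. x))"
  have Suc: "Y (Suc k) = \<Phi> (Y k)" for k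
    by (simp add: Y_def)
  have M0: "0 \<le> M"
    using M[of 0] norm_ge_zero order_trans by blast
  have lip: "M-lipschitz_on UNIV (Y k)" for k
  proof (induction k)
    case 0
    show ?case
      using M0 by (auto simp: Y_def intro!: lipschitz_onI)
  next
    case (Suc k)
    have "continuous_on UNIV (\<lambda>s. F (Y k (s - h)))"
      by (intro continuous_on_compose2[OF F] continuous_on_compose2[OF lipschitz_on_continuous_on[OF Suc]]
          continuous_intros) auto
    then show ?case
      unfolding Y_def funpow.simps comp_def \<Phi>_def
      using lipschitz_on_integral M by (auto simp: Y_def \<Phi>_def)
  qed
  have stable: "Y k t = Y (Suc k) t" if "t \<le> real k * h" for k t
    using that
  proof (induction k arbitrary: t)
    case 0
    then have "integral {0..t} (\<lambda>s. F (Y 0 (s - h))) = 0"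
      by (cases "t = 0") auto
    then show ?case
      by (simp add: Y_def \<Phi>_def)
  next
    case (Suc k)
    have "integral {0..t} (\<lambda>s. F (Y k (s - h))) = integral {0..t} (\<lambda>s. F (Y (Suc k) (s - h)))"
    proof (rule integral_cong)
      fix s assume "s \<in> {0..t}"
      then have "s - h \<le> real k * h"
        using Suc.prems by (simp add: algebra_simps)
      then show "F (Y k (s - h)) = F (Y (Suc k) (s - h))"
        using Suc.IH by metis
    qed
    then show ?case
      by (simp only: \<open>\<And>k. Y (Suc k) = \<Phi> (Y k)\<close>) (simp add: \<Phi>_def \<open>\<And>k. Y (Suc k) = \<Phi> (Y k)\<close>)
  qed
  \<comment> \<open>After \<open>T / h\<close> steps the iterates no longer change on \<open>(-\<infinity>, T]\<close>.\<close>
  define K where "K = nat \<lceil>T / h\<rceil>"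
  have K: "t \<le> real K * h" if "t \<le> T" for t
  proof -
    have "T / h \<le> real K"
      unfolding K_def by linarith
    then show ?thesis
      using h that by (simp add: field_simps)
  qed
  show thesis
  proof
    show "M-lipschitz_on UNIV (Y K)" by (rule lip)
    show "Y K 0 = x"
      by (cases K) (simp_all add: Y_def \<Phi>_def)
    show "Y K t = x + integral {0..t} (\<lambda>s. F (Y K (s - h)))" if "t \<le> T" for t
      using stable[OF K[OF that]] unfolding Suc \<Phi>_def .
  qed
qed

text \<open>A pointwise form of Arzela and Ascoli on the whole line: a diagonal sequence converges at
  the rationals, and the common Lipschitz constant carries convergence over to the reals.\<close>

lemma lipschitz_pointwise_convergent_subsequence:
  fixes Z :: "nat \<Rightarrow> real \<Rightarrow> 'a::euclidean_space"
  assumes lip: "\<And>n. M-lipschitz_on UNIV (Z n)" and start: "\<And>n. Z n 0 = x"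
  obtains k y where "strict_mono (k::nat \<Rightarrow> nat)" "\<And>t. (\<lambda>n. Z (k n) t) \<longlonglongrightarrow> y t"
    "M-lipschitz_on UNIV y"
proof -
  have M0: "0 \<le> M"
    using lip lipschitz_on_nonneg by blast
  \<comment> \<open>The weight turns the linear growth of the \<open>Z n\<close> into a bound uniform in \<open>t\<close>, as the diagonal
    argument requires.\<close>
  define f where "f = (\<lambda>n t. (1 / (1 + \<bar>t\<bar>)) *\<^sub>R (Z n t - x))"
  have "norm (f n t) \<le> M" for n t
  proof -
    have "norm (Z n t - x) \<le> M * \<bar>t\<bar>"
      using lipschitz_onD[OF lip, of t 0 n] start by (simp add: dist_norm)
    also have "\<dots> \<le> M * (1 + \<bar>t\<bar>)"
      using M0 by (simp add: mult_left_mono)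
    finally show ?thesis
      by (simp add: f_def divide_simps)
  qed
  then obtain k where k: "strict_mono (k::nat\<Rightarrow>nat)"
    and conv: "\<And>t. t \<in> \<rat> \<Longrightarrow> \<exists>l. (\<lambda>n. f (k n) t) \<longlonglongrightarrow> l"
    using function_convergent_subsequence[of "\<rat> :: real set" f M] countable_rat by metis
  have rat: "Cauchy (\<lambda>n. Z (k n) t)" if t: "t \<in> \<rat>" for t
  proof -
    obtain l where l: "(\<lambda>n. f (k n) t) \<longlonglongrightarrow> l"
      using conv[OF t] by blast
    have "(\<lambda>n. x + (1 + \<bar>t\<bar>) *\<^sub>R f (k n) t) \<longlonglongrightarrow> x + (1 + \<bar>t\<bar>) *\<^sub>R l"
      by (intro tendsto_intros l)
    moreover have "x + (1 + \<bar>t\<bar>) *\<^sub>R f (k n) t = Z (k n) t" for n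
      by (simp add: f_def add_nonneg_eq_0_iff)
    ultimately have "(\<lambda>n. Z (k n) t) \<longlonglongrightarrow> x + (1 + \<bar>t\<bar>) *\<^sub>R l"
      by simp
    then show ?thesis
      by (rule LIMSEQ_imp_Cauchy)
  qed
  have "convergent (\<lambda>n. Z (k n) t)" for t
    unfolding Cauchy_convergent_iff[symmetric]
  proof (rule metric_CauchyI)
    fix e :: real assume e: "0 < e"
    define d where "d = e / (3 * (M + 1))"
    have d: "0 < d"
      using e M0 by (simp add: d_def)
    obtain r where r: "r \<in> \<rat>" "t < r" "r < t + d"
      using Rats_dense_in_real[of t "t + d"] d by auto
    obtain N where N: "\<And>m n. N \<le> m \<Longrightarrow> N \<le> n \<Longrightarrow> dist (Z (k m) r) (Z (k n) r) < e / 3"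
      using metric_CauchyD[OF rat[OF r(1)], of "e / 3"] e by auto
    have near: "dist (Z n t) (Z n r) \<le> e / 3" for n
    proof -
      have "dist (Z n t) (Z n r) \<le> M * dist t r"
        using lipschitz_onD[OF lip] by blast
      also have "\<dots> \<le> (M + 1) * d"
        using r M0 by (intro mult_mono) (auto simp: dist_real_def)
      also have "\<dots> = e / 3"
        using M0 by (simp add: d_def field_simps add_nonneg_eq_0_iff)
      finally show ?thesis .
    qed
    show "\<exists>N. \<forall>m\<ge>N. \<forall>n\<ge>N. dist (Z (k m) t) (Z (k n) t) < e"
    proof (intro exI allI impI)
      fix m n assume "N \<le> m" "N \<le> n"
      then have "dist (Z (k m) r) (Z (k n) r) < e / 3"
        by (rule N)
      then show "dist (Z (k m) t) (Z (k n) t) < e"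
        using near[of "k m"] near[of "k n"]
          dist_triangle[of "Z (k m) t" "Z (k n) t" "Z (k m) r"]
          dist_triangle2[of "Z (k m) r" "Z (k n) t" "Z (k n) r"] by linarith
    qed
  qed
  then obtain y where y: "\<And>t. (\<lambda>n. Z (k n) t) \<longlonglongrightarrow> y t"
    unfolding convergent_def by metis
  have "M-lipschitz_on UNIV y"
  proof (rule lipschitz_onI)
    fix s t
    have "(\<lambda>n. dist (Z (k n) s) (Z (k n) t)) \<longlonglongrightarrow> dist (y s) (y t)"
      by (intro tendsto_intros y)
    then show "dist (y s) (y t) \<le> M * dist s t"
      by (rule LIMSEQ_le_const2) (use lipschitz_onD[OF lip] in blast)
  qed (rule M0)
  with k y show thesis
    using that by blast
qed

text \<open>Boundedness of \<open>F\<close> gives all delayed solutions the same Lipschitz constant, so that a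
  subsequence converges at all times at once, and dominated convergence passes to the limit in the
  integral equation.\<close>

theorem peano_bounded:
  fixes F :: "'a::euclidean_space \<Rightarrow> 'a"
  assumes F: "continuous_on UNIV F" and bdd: "bounded (range F)"
  obtains y where "trajectory F x {0..} y"
proof -
  obtain M where M: "\<And>z. norm (F z) \<le> M"
    using bdd by (auto simp: bounded_iff)
  define h where "h = (\<lambda>n. inverse (real (Suc n)))"
  have "\<forall>n. \<exists>Z. M-lipschitz_on UNIV Z \<and> Z 0 = x \<and>
      (\<forall>t\<le>real n. Z t = x + integral {0..t} (\<lambda>s. F (Z (s - h n))))"
  proof
    fix n
    have "0 < h n"
      by (simp add: h_def)
    then show "\<exists>Z. M-lipschitz_on UNIV Z \<and> Z 0 = x \<and>
      (\<forall>t\<le>real n. Z t = x + integral {0..t} (\<lambda>s. F (Z (s - h n))))"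
      using delay_equation_solution[OF F M, of "h n" x "real n"] by blast
  qed
  from choice[OF this] obtain Z where Z: "\<forall>n. M-lipschitz_on UNIV (Z n) \<and> Z n 0 = x \<and>
      (\<forall>t\<le>real n. Z n t = x + integral {0..t} (\<lambda>s. F (Z n (s - h n))))" ..
  have lip: "\<And>n. M-lipschitz_on UNIV (Z n)" and start: "\<And>n. Z n 0 = x"
    and eq: "\<And>n t. t \<le> real n \<Longrightarrow> Z n t = x + integral {0..t} (\<lambda>s. F (Z n (s - h n)))"
    by (simp_all only: Z)
  obtain k y where k: "strict_mono (k::nat \<Rightarrow> nat)" and y: "\<And>t. (\<lambda>n. Z (k n) t) \<longlonglongrightarrow> y t"
    and ylip: "M-lipschitz_on UNIV y"
    by (rule lipschitz_pointwise_convergent_subsequence[of M Z x, OF lip start]) (rule that)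
  have h: "(\<lambda>n. h (k n)) \<longlonglongrightarrow> 0"
    using LIMSEQ_subseq_LIMSEQ[OF LIMSEQ_inverse_real_of_nat k] by (simp add: h_def comp_def)
  have delayed: "(\<lambda>n. Z (k n) (s - h (k n))) \<longlonglongrightarrow> y s" for s
  proof -
    have "(\<lambda>n. Z (k n) (s - h (k n)) - Z (k n) s) \<longlonglongrightarrow> 0"
    proof (rule Lim_null_comparison)
      show "\<forall>\<^sub>F n in sequentially. norm (Z (k n) (s - h (k n)) - Z (k n) s) \<le> M * \<bar>h (k n)\<bar>"
      proof (intro always_eventually allI)
        fix n
        show "norm (Z (k n) (s - h (k n)) - Z (k n) s) \<le> M * \<bar>h (k n)\<bar>"
          using lipschitz_onD[OF lip, of "s - h (k n)" s "k n"] by (simp add: dist_norm)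
      qed
      show "(\<lambda>n. M * \<bar>h (k n)\<bar>) \<longlonglongrightarrow> 0"
        using tendsto_mult_right_zero[OF tendsto_rabs_zero[OF h]] by simp
    qed
    from tendsto_add[OF this y[of s]] show ?thesis
      by simp
  qed
  have Fi: "isCont F z" for z
    using F by (simp add: continuous_on_eq_continuous_at)
  have "y t = x + integral {0..t} (\<lambda>s. F (y s))" if t: "0 \<le> t" for t
  proof -
    have "(\<lambda>n. integral {0..t} (\<lambda>s. F (Z (k n) (s - h (k n))))) \<longlonglongrightarrow> integral {0..t} (\<lambda>s. F (y s))"
    proof (rule dominated_convergence(2)[where h = "\<lambda>_. M"])
      show "(\<lambda>s. F (Z (k n) (s - h (k n)))) integrable_on {0..t}" for n
        by (intro integrable_continuous_real continuous_on_compose2[OF F]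
            continuous_on_compose2[OF lipschitz_on_continuous_on[OF lip]] continuous_intros) auto
      show "(\<lambda>n. F (Z (k n) (s - h (k n)))) \<longlonglongrightarrow> F (y s)" for s
        by (rule isCont_tendsto_compose[OF Fi delayed])
    qed (use M in auto)
    then have "(\<lambda>n. x + integral {0..t} (\<lambda>s. F (Z (k n) (s - h (k n))))) \<longlonglongrightarrow> x + integral {0..t} (\<lambda>s. F (y s))"
      by (intro tendsto_intros)
    moreover have "\<forall>\<^sub>F n in sequentially. x + integral {0..t} (\<lambda>s. F (Z (k n) (s - h (k n)))) = Z (k n) t"
    proof (rule eventually_sequentiallyI[of "nat \<lceil>t\<rceil>"])
      fix n assume "nat \<lceil>t\<rceil> \<le> n"
      then have "t \<le> real (k n)"
        using seq_suble[OF k, of n] by linarith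
      then show "x + integral {0..t} (\<lambda>s. F (Z (k n) (s - h (k n)))) = Z (k n) t"
        using eq by simp
    qed
    ultimately have "(\<lambda>n. Z (k n) t) \<longlonglongrightarrow> x + integral {0..t} (\<lambda>s. F (y s))"
      by (rule Lim_transform_eventually)
    then show ?thesis
      using y LIMSEQ_unique by blast
  qed
  then have "trajectory F x {0..} y"
    using trajectory_of_integral_equation[OF F] continuous_on_subset[OF lipschitz_on_continuous_on[OF ylip]]
    by blast
  then show thesis ..
qed

section \<open>Energy along trajectories\<close>

text \<open>Translates bounds on the cost over finite horizons into a bound on \<^const>\<open>cost\<close>.\<close>

lemma nn_integral_half_line_le:
  fixes h :: "real \<Rightarrow> real"
  assumes h: "continuous_on {0..} h" and nonneg: "\<And>t. 0 \<le> t \<Longrightarrow> 0 \<le> h t"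
    and le: "\<And>T. 0 \<le> T \<Longrightarrow> integral {0..T} h \<le> B"
  shows "(\<integral>\<^sup>+ t. ennreal (h t) \<partial>lebesgue_on {0..}) \<le> ennreal B"
proof -
  have meas: "h \<in> borel_measurable (lebesgue_on {0..})"
    by (rule continuous_imp_measurable_on_sets_lebesgue[OF h]) simp
  have piece: "(\<integral>\<^sup>+ t. ennreal (h t) * indicator {0..real n} t \<partial>lebesgue_on {0..}) \<le> ennreal B" for n
  proof -
    have "continuous_on {0..real n} h"
      by (rule continuous_on_subset[OF h]) auto
    then have int: "integrable (lebesgue_on {0..real n}) h"
      by (rule continuous_imp_integrable_real)
    have "(\<integral>\<^sup>+ t. ennreal (h t) * indicator {0..real n} t \<partial>lebesgue_on {0..})
        = (\<integral>\<^sup>+ t. ennreal (h t) \<partial>lebesgue_on {0..real n})"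
      by (auto simp: nn_integral_restrict_space indicator_def intro!: nn_integral_cong)
    also have "\<dots> = ennreal (integral\<^sup>L (lebesgue_on {0..real n}) h)"
      by (rule nn_integral_eq_integral[OF int]) (auto intro!: AE_I2 nonneg simp: space_restrict_space)
    also have "integral\<^sup>L (lebesgue_on {0..real n}) h = integral {0..real n} h"
      by (rule lebesgue_integral_eq_integral[OF int]) simp
    also have "ennreal \<dots> \<le> ennreal B"
      by (intro ennreal_leI le) simp
    finally show ?thesis .
  qed
  have "(\<integral>\<^sup>+ t. ennreal (h t) \<partial>lebesgue_on {0..})
      = (\<integral>\<^sup>+ t. (SUP n. ennreal (h t) * indicator {0..real n} t) \<partial>lebesgue_on {0..})"
  proof (rule nn_integral_cong)
    fix t assume "t \<in> space (lebesgue_on {0::real..})"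
    then have t: "0 \<le> t"
      by (simp add: space_restrict_space)
    show "ennreal (h t) = (SUP n. ennreal (h t) * indicator {0..real n} t)"
    proof (rule antisym)
      have "ennreal (h t) = ennreal (h t) * indicator {0..real (nat \<lceil>t\<rceil>)} t"
        using t by (simp add: indicator_def real_nat_ceiling_ge)
      also have "\<dots> \<le> (SUP n. ennreal (h t) * indicator {0..real n} t)"
        by (rule SUP_upper) simp
      finally show "ennreal (h t) \<le> (SUP n. ennreal (h t) * indicator {0..real n} t)" .
      show "(SUP n. ennreal (h t) * indicator {0..real n} t) \<le> ennreal (h t)"
        by (rule SUP_least) (simp add: indicator_def)
    qed
  qed
  also have "\<dots> = (SUP n. \<integral>\<^sup>+ t. ennreal (h t) * indicator {0..real n} t \<partial>lebesgue_on {0..})"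
  proof (rule nn_integral_monotone_convergence_SUP)
    show "incseq (\<lambda>n t. ennreal (h t) * indicator {0..real n} t)"
      by (auto simp: incseq_def le_fun_def indicator_def)
    show "(\<lambda>t. ennreal (h t) * indicator {0..real n} t) \<in> borel_measurable (lebesgue_on {0..})" for n
    proof -
      have "indicator {0..real n} \<in> borel_measurable (lebesgue_on {0::real..})"
        by (intro measurable_restrict_space1 borel_measurable_indicator) simp
      then show ?thesis
        using meas by (intro borel_measurable_times_ennreal) auto
    qed
  qed
  also have "\<dots> \<le> ennreal B"
    by (rule SUP_least) (rule piece)
  finally show ?thesis .
qed

text \<open>The definition of \<^const>\<open>gradient\<close> selects the Riesz representative of the derivative, which is
  here supplied by the adjoint.\<close>

lemma C1_has_derivative:
  fixes W :: "'a::euclidean_space \<Rightarrow> real"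
  assumes "C1 W"
  shows "(W has_derivative (\<lambda>h. h \<bullet> gradient W x)) (at x)"
proof -
  obtain D where D: "(W has_derivative D) (at x)"
    using assms unfolding C1_def differentiable_def by blast
  have "(\<lambda>h. h \<bullet> adjoint D 1) = D"
    using adjoint_works[OF has_derivative_linear[OF D], of _ 1] by auto
  then have G: "GDERIV W x :> adjoint D 1"
    unfolding gderiv_def by (simp add: D)
  have "GDERIV W x :> gradient W x"
    unfolding gradient_def
  proof (rule theI[where P = "\<lambda>D. GDERIV W x :> D", OF G])
    fix E assume "GDERIV W x :> E"
    then have "(\<lambda>h. h \<bullet> E) = (\<lambda>h. h \<bullet> adjoint D 1)"
      using G unfolding gderiv_def by (rule has_derivative_unique)
    then have "h \<bullet> E = h \<bullet> adjoint D 1" for h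
      by (rule fun_cong)
    then show "E = adjoint D 1"
      using vector_eq_ldot by blast
  qed
  then show ?thesis
    by (simp add: gderiv_def)
qed

lemma C1_continuous_on:
  fixes W :: "'a::euclidean_space \<Rightarrow> real"
  shows "C1 W \<Longrightarrow> continuous_on S W"
  using C1_has_derivative[THEN has_derivative_at_withinI] by (rule has_derivative_continuous_on)

lemma C1_local_min_gradient:
  fixes W :: "'a::euclidean_space \<Rightarrow> real"
  assumes "C1 W" "open S" "x \<in> S" "\<And>z. z \<in> S \<Longrightarrow> W x \<le> W z"
  shows "gradient W x = 0"
proof -
  have "(\<lambda>h. h \<bullet> gradient W x) = (\<lambda>h. 0)"
    using differential_zero_maxmin[OF assms(3,2) C1_has_derivative[OF assms(1)]] assms(4) by blast
  from fun_cong[OF this, of "gradient W x"] show ?thesis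
    by simp
qed

lemma trajectory_energy:
  fixes F :: "'a::euclidean_space \<Rightarrow> 'a"
  assumes W: "C1 W" and y: "trajectory F x I y" and st: "{s..t} \<subseteq> I" "s \<le> t"
  shows "((\<lambda>r. gradient W (y r) \<bullet> F (y r)) has_integral (W (y t) - W (y s))) {s..t}"
proof (rule fundamental_theorem_of_calculus[OF st(2)])
  fix r assume "r \<in> {s..t}"
  then have "(y has_derivative (\<lambda>h. h *\<^sub>R F (y r))) (at r within {s..t})"
    using trajectory_subset[OF y st(1)] by (simp add: trajectory_def has_vector_derivative_def)
  from has_derivative_compose[OF this C1_has_derivative[OF W]]
  show "((\<lambda>r. W (y r)) has_vector_derivative gradient W (y r) \<bullet> F (y r)) (at r within {s..t})"
    by (simp add: has_vector_derivative_def inner_commute)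
qed

lemma trajectory_energy_le:
  fixes F :: "'a::euclidean_space \<Rightarrow> 'a"
  assumes W: "C1 W" and y: "trajectory F x I y" and st: "{s..t} \<subseteq> I" "s \<le> t"
    and q: "continuous_on UNIV q" and le: "\<And>z. gradient W z \<bullet> F z \<le> - q z"
  shows "W (y t) + integral {s..t} (\<lambda>r. q (y r)) \<le> W (y s)"
proof -
  have "continuous_on {s..t} (\<lambda>r. q (y r))"
    by (rule continuous_on_compose2[OF q continuous_on_subset[OF trajectory_continuous_on[OF y] st(1)]]) auto
  then have int: "((\<lambda>r. q (y r)) has_integral integral {s..t} (\<lambda>r. q (y r))) {s..t}"
    by (intro integrable_integral integrable_continuous_real)
  have "W (y t) - W (y s) \<le> - integral {s..t} (\<lambda>r. q (y r))"
    by (rule has_integral_le[OF trajectory_energy[OF W y st] has_integral_neg[OF int]]) (rule le)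
  then show ?thesis
    by simp
qed

lemma continuous_on_compact_norm_bound:
  fixes F :: "'a::topological_space \<Rightarrow> 'b::real_normed_vector"
  assumes "compact K" "continuous_on K F"
  obtains M where "\<And>z. z \<in> K \<Longrightarrow> norm (F z) \<le> M"
proof -
  have "bounded (F ` K)"
    by (intro compact_imp_bounded compact_continuous_image assms)
  then obtain M where "\<forall>z\<in>F ` K. norm z \<le> M"
    unfolding bounded_iff ..
  then show thesis
    using that by blast
qed

text \<open>As \<open>F\<close> need not be bounded, it is first cut off outside the component. Multiplication with a
  cut-off factor in \<open>[0, 1]\<close> keeps \<open>W\<close> nonincreasing along trajectories, so the path cannot leave
  the component, and there the cut-off is invisible.\<close>

lemma trajectory_in_sublevel_component:
  fixes F :: "'a::euclidean_space \<Rightarrow> 'a"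
  assumes F: "continuous_on UNIV F" and W: "C1 W" and le: "\<And>z. gradient W z \<bullet> F z \<le> 0"
    and bdd: "bounded (connected_component_set {z. W z < c} p)"
    and x: "x \<in> connected_component_set {z. W z < c} p"
  obtains y where "trajectory F x {0..} y"
    "\<And>t. 0 \<le> t \<Longrightarrow> y t \<in> connected_component_set {z. W z < c} p"
proof -
  let ?C = "connected_component_set {z. W z < c} p"
  obtain r where r: "\<And>z. z \<in> ?C \<Longrightarrow> norm z \<le> r"
    using bdd by (auto simp: bounded_iff)
  define \<theta> where "\<theta> = (\<lambda>z::'a. max 0 (min 1 (r + 1 - norm z)))"
  define G where "G = (\<lambda>z. \<theta> z *\<^sub>R F z)"
  have \<theta>: "0 \<le> \<theta> z" "\<theta> z \<le> 1" for z
    by (auto simp: \<theta>_def)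
  have G: "continuous_on UNIV G"
    unfolding G_def \<theta>_def by (intro continuous_intros F)
  obtain M where M: "\<And>z. z \<in> cball 0 (r + 1) \<Longrightarrow> norm (F z) \<le> M"
    using continuous_on_compact_norm_bound[OF compact_cball continuous_on_subset[OF F]] by blast
  have "norm (G z) \<le> max 0 M" for z
  proof (cases "norm z \<le> r + 1")
    case True
    have "\<theta> z * norm (F z) \<le> 1 * norm (F z)"
      using \<theta> by (intro mult_right_mono) auto
    then show ?thesis
      using M[of z] True \<theta>[of z] by (simp add: G_def)
  next
    case False
    then show ?thesis
      by (simp add: G_def \<theta>_def)
  qed
  then have "bounded (range G)"
    by (auto simp: bounded_iff)
  then obtain y where y: "trajectory G x {0..} y"
    using peano_bounded[OF G] by blast
  have leG: "gradient W z \<bullet> G z \<le> - 0" for z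
    using le \<theta>[of z] by (simp add: G_def mult_nonneg_nonpos)
  have in_C: "y t \<in> ?C" if t: "0 \<le> t" for t
  proof -
    have "y ` {0..t} \<subseteq> {z. W z < c}"
    proof clarsimp
      fix s assume s: "0 \<le> s" "s \<le> t"
      have "W (y s) \<le> W (y 0)"
        using trajectory_energy_le[OF W y _ s(1) continuous_on_const leG] by simp
      also have "\<dots> < c"
        using x y connected_component_in by (fastforce simp: trajectory_def)
      finally show "W (y s) < c" .
    qed
    moreover have "connected (y ` {0..t})"
      by (rule connected_continuous_image[OF continuous_on_subset[OF trajectory_continuous_on[OF y]]]) auto
    moreover have "x \<in> y ` {0..t}"
      using y t by (force simp: trajectory_def)
    ultimately have "y ` {0..t} \<subseteq> connected_component_set {z. W z < c} x"
      by (intro connected_component_maximal)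
    then show ?thesis
      unfolding connected_component_eq[OF x] using t by force
  qed
  have "G (y t) = F (y t)" if "0 \<le> t" for t
    using r[OF in_C[OF that]] by (simp add: G_def \<theta>_def)
  then have "trajectory F x {0..} y"
    using y by (simp add: trajectory_def)
  then show thesis
    using in_C by (rule that)
qed

text \<open>Confinement to a compact set bounds the speed, so the trajectory is Lipschitz and has a
  limit at time \<open>T\<close>, from which a global trajectory continues it. The concatenation is recognised
  as a trajectory by the integral equation, which makes the junction unproblematic.\<close>

lemma trajectory_extend:
  fixes F :: "'a::euclidean_space \<Rightarrow> 'a"
  assumes F: "continuous_on UNIV F" and T: "0 < T" and y: "trajectory F x {0..<T} y"
    and K: "compact K" "\<And>t. t \<in> {0..<T} \<Longrightarrow> y t \<in> K"
    and global: "\<And>p. \<exists>w. trajectory F p {0..} w"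
  obtains z where "trajectory F x {0..} z" "\<And>t. t \<in> {0..<T} \<Longrightarrow> z t = y t"
proof -
  obtain M where M: "\<And>z. z \<in> K \<Longrightarrow> norm (F z) \<le> M"
    using continuous_on_compact_norm_bound[OF K(1) continuous_on_subset[OF F]] by blast
  have M0: "0 \<le> M"
    using order.trans[OF norm_ge_zero M[OF K(2)[of 0]]] T by simp
  have ycont: "continuous_on {0..<T} (\<lambda>t. F (y t))"
    by (rule continuous_on_compose2[OF F trajectory_continuous_on[OF y]]) simp
  have "norm (y t - y s) \<le> M * (t - s)" if st: "0 \<le> s" "s \<le> t" "t < T" for s t
  proof -
    have sub: "{s..t} \<subseteq> {0..<T}"
      using st by auto
    have "y t - y s = integral {s..t} (\<lambda>r. F (y r))"
      using trajectory_has_integral[OF y sub st(2)] by (simp add: integral_unique)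
    also have "norm \<dots> \<le> M * (t - s)"
      by (rule integral_bound[OF st(2) continuous_on_subset[OF ycont sub]]) (use M K sub in auto)
    finally show ?thesis .
  qed
  then have "norm (y t - y s) \<le> M * \<bar>t - s\<bar>" if "t \<in> {0..<T}" "s \<in> {0..<T}" for s t
    using that
  proof (induction s t rule: linorder_wlog)
    case (sym s t)
    then show ?case
      by (simp add: norm_minus_commute abs_minus_commute)
  qed (use \<open>\<And>s t. 0 \<le> s \<Longrightarrow> s \<le> t \<Longrightarrow> t < T \<Longrightarrow> norm (y t - y s) \<le> M * (t - s)\<close> in auto)
  then have "M-lipschitz_on {0..<T} y"
    using M0 by (auto intro!: lipschitz_onI simp: dist_norm)
  then obtain e where e: "M-lipschitz_on {0..T} e" and ey: "\<And>t. t \<in> {0..<T} \<Longrightarrow> e t = y t"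
    using lipschitz_extend_closure[of M "{0..<T}" y] T by (auto simp: closure_atLeastLessThan)
  obtain w where w: "trajectory F (e T) {0..} w"
    using global by blast
  define z where "z = (\<lambda>t. if t \<le> T then e t else w (t - T))"
  have econt: "continuous_on {0..T} e"
    using e lipschitz_on_continuous_on by blast
  have zcont: "continuous_on {0..} z"
    unfolding z_def
  proof (rule continuous_on_cases_1)
    show "continuous_on {t \<in> {0..}. t \<le> T} e"
      by (rule continuous_on_subset[OF econt]) auto
    show "continuous_on {t \<in> {0..}. T \<le> t} (\<lambda>t. w (t - T))"
      by (rule continuous_on_compose2[OF trajectory_continuous_on[OF w]]) (auto intro!: continuous_intros)
    show "e T = w (T - T)"
      using w by (simp add: trajectory_def)
  qed
  have Fz: "continuous_on {0..} (\<lambda>t. F (z t))"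
    by (rule continuous_on_compose2[OF F zcont]) simp
  then have Fz_int: "(\<lambda>t. F (z t)) integrable_on {a..b}" if "0 \<le> a" for a b
    by (intro integrable_continuous_real continuous_on_subset[OF Fz]) (use that in auto)
  have zy: "z t = y t" if "t \<in> {0..<T}" for t
    using that ey by (simp add: z_def)
  have eq1: "z t - integral {0..t} (\<lambda>r. F (z r)) = x" if "t \<in> {0..<T}" for t
  proof -
    have "integral {0..t} (\<lambda>r. F (z r)) = integral {0..t} (\<lambda>r. F (y r))"
      by (rule integral_cong) (use that zy in auto)
    also have "\<dots> = y t - y 0"
      by (rule integral_unique[OF trajectory_has_integral[OF y]]) (use that in auto)
    finally show ?thesis
      using zy[OF that] y by (simp add: trajectory_def)
  qed
  have eq2: "z t - integral {0..t} (\<lambda>r. F (z r)) = x" if "t \<in> {0..T}" for t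
  proof (rule continuous_constant_on_closure[where S = "{0..<T}"])
    show "continuous_on (closure {0..<T}) (\<lambda>t. z t - integral {0..t} (\<lambda>r. F (z r)))"
      using T Fz_int continuous_on_subset[OF zcont, of "{0..T}"]
      by (auto simp: closure_atLeastLessThan intro!: continuous_on_diff indefinite_integral_continuous_1)
    show "t \<in> closure {0..<T}"
      using that T by (simp add: closure_atLeastLessThan)
  qed (rule eq1)
  have "z t = x + integral {0..t} (\<lambda>r. F (z r))" if t: "0 \<le> t" for t
  proof (cases "t \<le> T")
    case True
    then show ?thesis
      using eq2[of t] t by (simp add: algebra_simps)
  next
    case False
    have zw: "z (T + s) = w s" if "0 \<le> s" for s
      using that w by (cases "s = 0") (auto simp: z_def trajectory_def)
    have "w (t - T) - w 0 = integral {0..t - T} (\<lambda>r. F (w r))"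
      using integral_unique[OF trajectory_has_integral[OF w, of 0 "t - T"]] False by simp
    also have "\<dots> = integral {0..t - T} ((\<lambda>r. F (z r)) \<circ> (+) T)"
      by (rule integral_cong) (simp add: zw)
    also have "\<dots> = integral {T..t} (\<lambda>r. F (z r))"
      using integral_shift_Icc_real[of 0 "t - T" "\<lambda>r. F (z r)" T] by simp
    finally have "z t = z T + integral {T..t} (\<lambda>r. F (z r))"
      using False zw[of 0] zw[of "t - T"] by (simp add: algebra_simps)
    moreover have "z T = x + integral {0..T} (\<lambda>r. F (z r))"
      using eq2[of T] T by (simp add: algebra_simps)
    moreover have "integral {0..T} (\<lambda>r. F (z r)) + integral {T..t} (\<lambda>r. F (z r)) = integral {0..t} (\<lambda>r. F (z r))"
      by (rule Henstock_Kurzweil_Integration.integral_combine) (use False T Fz_int in auto)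
    ultimately show ?thesis
      by (simp add: algebra_simps)
  qed
  then have "trajectory F x {0..} z"
    by (rule trajectory_of_integral_equation[OF F zcont])
  then show thesis
    using zy by (rule that)
qed

section \<open>Strict dissipation\<close>

text \<open>A strict Lyapunov function for \<open>F\<close> with dissipation rate \<open>q\<close>, except that \<open>W\<close> may take
  negative values: the sign of a policy value is at the outset known only near the origin, and has
  to be derived elsewhere. Both the value function of the current policy and that of its
  predecessor appear as \<open>W\<close> for the same closed loop.\<close>

locale dissipation =
  fixes F :: "'a::euclidean_space \<Rightarrow> 'a" and W q :: "'a \<Rightarrow> real"
  assumes F_cont: "continuous_on UNIV F"
    and W_C1: "C1 W" and W_zero: "W 0 = 0"
    and q_cont: "continuous_on UNIV q" and q_nonneg: "\<And>z. 0 \<le> q z"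
    and q_pos: "\<And>z. z \<noteq> 0 \<Longrightarrow> 0 < q z"
    and dissipates: "\<And>z. gradient W z \<bullet> F z \<le> - q z"
begin

lemma W_cont: "continuous_on S W"
  by (rule C1_continuous_on[OF W_C1])

lemma W_small_near_0:
  assumes "0 < e"
  obtains d where "0 < d" "\<And>z. norm z < d \<Longrightarrow> \<bar>W z\<bar> < e"
proof -
  have "continuous (at 0) W"
    using W_cont[of UNIV] by (simp add: continuous_on_eq_continuous_at)
  then obtain d where "0 < d" "\<And>z. dist z 0 < d \<Longrightarrow> dist (W z) (W 0) < e"
    using assms unfolding continuous_at_eps_delta by (metis dist_commute)
  then show thesis
    using that W_zero by (simp add: dist_norm)
qed

text \<open>A zero of \<open>W\<close> inside \<open>S\<close> would be a local minimum, whereas dissipation excludes critical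
  points other than the origin.\<close>

lemma W_pos_of_nonneg:
  assumes "open S" "\<And>z. z \<in> S \<Longrightarrow> 0 \<le> W z" "z \<in> S" "z \<noteq> 0"
  shows "0 < W z"
proof (rule ccontr)
  assume "\<not> 0 < W z"
  then have "gradient W z = 0"
    using assms by (intro C1_local_min_gradient[OF W_C1 assms(1,3)]) force
  then show False
    using dissipates[of z] q_pos[OF assms(4)] by simp
qed

lemma q_trajectory_integrable:
  assumes "trajectory F x {0..} y" "0 \<le> s"
  shows "(\<lambda>r. q (y r)) integrable_on {s..t}"
  by (intro integrable_continuous_real continuous_on_compose2[OF q_cont
        continuous_on_subset[OF trajectory_continuous_on[OF assms(1)]]]) (use assms in auto)

lemma energy_le:
  assumes "trajectory F x {0..} y" "0 \<le> s" "s \<le> t"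
  shows "W (y t) + integral {s..t} (\<lambda>r. q (y r)) \<le> W (y s)"
  by (rule trajectory_energy_le[OF W_C1 assms(1) _ _ q_cont dissipates]) (use assms in auto)

lemma energy_mono:
  assumes "trajectory F x {0..} y" "0 \<le> s" "s \<le> t"
  shows "W (y t) \<le> W (y s)"
proof -
  have "0 \<le> integral {s..t} (\<lambda>r. q (y r))"
    by (rule integral_nonneg[OF q_trajectory_integrable[OF assms(1,2)]]) (rule q_nonneg)
  then show ?thesis
    using energy_le[OF assms] by linarith
qed

text \<open>Staying away from the origin within \<open>K\<close> would cost at least a fixed rate forever, but \<open>W\<close> is
  bounded below on \<open>K\<close>.\<close>

lemma trajectory_hits_small_ball:
  assumes y: "trajectory F x {0..} y" and K: "compact K" "\<And>t. 0 \<le> t \<Longrightarrow> y t \<in> K"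
    and e: "0 < e" and T: "0 \<le> T"
  obtains t where "T \<le> t" "norm (y t) < e"
proof (rule ccontr)
  assume "\<not> thesis"
  then have far: "e \<le> norm (y t)" if "T \<le> t" for t
    using that \<open>\<And>t. T \<le> t \<Longrightarrow> norm (y t) < e \<Longrightarrow> thesis\<close> by (meson not_le)
  have "y T \<in> K - ball 0 e"
    using K(2)[OF T] far[of T] by simp
  then have K': "compact (K - ball 0 e)" "K - ball 0 e \<noteq> {}"
    using K(1) by (auto intro: compact_diff)
  obtain p where p: "p \<in> K - ball 0 e" "\<And>z. z \<in> K - ball 0 e \<Longrightarrow> q p \<le> q z"
    using continuous_attains_inf[OF K' continuous_on_subset[OF q_cont]] by blast
  then have "0 < q p"
    using e by (intro q_pos) auto
  obtain b where b: "\<And>z. z \<in> K \<Longrightarrow> W b \<le> W z"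
    using continuous_attains_inf[OF K(1) _ W_cont] K' by blast
  \<comment> \<open>Late enough that the dissipated energy exceeds all that is available in \<open>K\<close>.\<close>
  define t where "t = T + (\<bar>W (y T) - W b\<bar> + 1) / q p"
  have t: "T \<le> t"
    using \<open>0 < q p\<close> by (simp add: t_def)
  have "\<bar>W (y T) - W b\<bar> + 1 = integral {T..t} (\<lambda>_. q p)"
    using t \<open>0 < q p\<close> by (simp add: t_def)
  also have "\<dots> \<le> integral {T..t} (\<lambda>r. q (y r))"
  proof (rule integral_le[OF integrable_const_ivl q_trajectory_integrable[OF y T]])
    fix r assume "r \<in> {T..t}"
    then have "y r \<in> K - ball 0 e"
      using K(2)[of r] far[of r] T by simp
    then show "q p \<le> q (y r)"
      by (rule p(2))
  qed
  also have "\<dots> \<le> W (y T) - W b"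
    using energy_le[OF y T t] b[OF K(2), of t] T t by linarith
  finally show False
    by linarith
qed

text \<open>The remaining energy \<open>W (y t)\<close> is arbitrarily small at arbitrarily late times \<open>t\<close>, even if
  \<open>W\<close> takes negative values.\<close>

lemma integral_q_le:
  assumes y: "trajectory F x {0..} y" and K: "compact K" "\<And>t. 0 \<le> t \<Longrightarrow> y t \<in> K"
    and T: "0 \<le> T"
  shows "integral {0..T} (\<lambda>r. q (y r)) \<le> W x"
proof (rule field_le_epsilon)
  fix e :: real assume "0 < e"
  then obtain d where d: "0 < d" "\<And>z. norm z < d \<Longrightarrow> \<bar>W z\<bar> < e"
    using W_small_near_0 by blast
  obtain t where t: "T \<le> t" "norm (y t) < d"
    using trajectory_hits_small_ball[OF y K d(1) T] by blast
  have "integral {0..T} (\<lambda>r. q (y r)) \<le> integral {0..t} (\<lambda>r. q (y r))"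
    by (rule integral_subset_le[OF _ q_trajectory_integrable[OF y] q_trajectory_integrable[OF y]])
      (use t q_nonneg in auto)
  also have "\<dots> \<le> W x - W (y t)"
    using energy_le[OF y, of 0 t] T t y by (simp add: trajectory_def)
  also have "\<dots> \<le> W x + e"
    using d(2)[OF t(2)] by linarith
  finally show "integral {0..T} (\<lambda>r. q (y r)) \<le> W x + e" .
qed

text \<open>The usual Lyapunov argument: some time the trajectory is so close to the origin that its
  energy is below the minimum of \<open>W\<close> on the part of \<open>K\<close> outside the \<open>e\<close>-ball; since energy never
  increases, it stays in that ball from then on.\<close>

lemma trajectory_tendsto_0:
  assumes y: "trajectory F x {0..} y" and K: "compact K" "\<And>t. 0 \<le> t \<Longrightarrow> y t \<in> K"
    and pos: "\<And>z. z \<noteq> 0 \<Longrightarrow> 0 < W z"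
  shows "(y \<longlongrightarrow> 0) at_top"
proof (rule tendstoI)
  fix e :: real assume e: "0 < e"
  obtain m where m: "0 < m" "\<And>z. z \<in> K - ball 0 e \<Longrightarrow> m \<le> W z"
  proof (cases "K - ball 0 e = {}")
    case True
    then show thesis
      by (intro that[of 1]) auto
  next
    case False
    have "compact (K - ball 0 e)"
      using K by (auto intro: compact_diff)
    then obtain p where p: "p \<in> K - ball 0 e" "\<And>z. z \<in> K - ball 0 e \<Longrightarrow> W p \<le> W z"
      using continuous_attains_inf[OF _ False W_cont] by blast
    have "p \<noteq> 0"
      using p(1) e by auto
    then show thesis
      by (intro that[of "W p"] pos p(2))
  qed
  obtain d where d: "0 < d" "\<And>z. norm z < d \<Longrightarrow> \<bar>W z\<bar> < m"
    using W_small_near_0[OF m(1)] by blast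
  obtain t where t: "0 \<le> t" "norm (y t) < d"
    using trajectory_hits_small_ball[OF y K d(1), of 0] by auto
  have "dist (y s) 0 < e" if "t \<le> s" for s
  proof -
    have "W (y s) < m"
      using energy_mono[OF y t(1) that] d(2)[OF t(2)] by linarith
    then have "y s \<notin> K - ball 0 e"
      using m(2) by fastforce
    then show ?thesis
      using K(2)[of s] t(1) that by (auto simp: dist_commute)
  qed
  then show "\<forall>\<^sub>F s in at_top. dist (y s) 0 < e"
    unfolding eventually_at_top_linorder by blast
qed

end

section \<open>Sublevel components and the passage from local to global\<close>

lemma C1_mean_value:
  fixes W :: "'a::euclidean_space \<Rightarrow> real"
  assumes W: "C1 W" and s: "0 < s"
  obtains \<tau> where "0 < \<tau>" "\<tau> < s" "W (x + s *\<^sub>R v) - W x = s * (gradient W (x + \<tau> *\<^sub>R v) \<bullet> v)"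
proof -
  have "((\<lambda>\<tau>. W (x + \<tau> *\<^sub>R v)) has_real_derivative gradient W (x + \<tau> *\<^sub>R v) \<bullet> v) (at \<tau>)" for \<tau>
  proof -
    have "((\<lambda>\<tau>. x + \<tau> *\<^sub>R v) has_derivative (\<lambda>h. h *\<^sub>R v)) (at \<tau>)"
      by (auto intro!: derivative_eq_intros)
    from has_derivative_compose[OF this C1_has_derivative[OF W]]
    show ?thesis
      by (simp add: has_field_derivative_def inner_commute mult_commute_abs)
  qed
  from MVT2[OF s, of "\<lambda>\<tau>. W (x + \<tau> *\<^sub>R v)", OF this] show thesis
    using that by auto
qed

text \<open>The part of a path up to its first exit from a ball.\<close>

lemma open_connected_exit_continuum:
  fixes D :: "'a::euclidean_space set"
  assumes "open D" "connected D" "0 \<in> D" "p \<in> D" "\<rho> \<le> norm p" "0 < \<rho>"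
  obtains P z where "connected P" "P \<subseteq> D" "P \<subseteq> cball 0 \<rho>" "0 \<in> P" "z \<in> P" "norm z = \<rho>"
proof -
  have "path_connected D"
    using assms by (simp add: connected_open_path_connected)
  then obtain g where g: "path g" "path_image g \<subseteq> D" "pathstart g = 0" "pathfinish g = p"
    using assms unfolding path_connected_def by blast
  have "pathstart g \<in> closure (ball 0 \<rho>)" "pathfinish g \<notin> ball 0 \<rho>"
    using g assms by auto
  then obtain h where h: "path h" "pathstart h = 0" "path_image h \<subseteq> path_image g"
      "path_image h - {pathfinish h} \<subseteq> ball 0 \<rho>" "pathfinish h \<in> sphere 0 \<rho>"
    using exists_path_subpath_to_frontier[OF g(1)] g(3) assms(6) by (metis frontier_ball interior_open open_ball)
  show thesis
  proof
    show "connected (path_image h)"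
      using h(1) by (rule connected_path_image)
    show "path_image h \<subseteq> D"
      using h g by blast
    show "path_image h \<subseteq> cball 0 \<rho>"
      using h(4,5) ball_subset_cball sphere_cball by blast
    show "0 \<in> path_image h"
      using h(2) pathstart_in_path_image by metis
    show "pathfinish h \<in> path_image h"
      by (rule pathfinish_in_path_image)
    show "norm (pathfinish h) = \<rho>"
      using h(5) by simp
  qed
qed

context dissipation
begin

text \<open>A well that is bounded traps trajectories. Wells, unlike full sublevel sets, can be
  controlled by what happens near the origin: a connected set through the origin cannot jump over
  a barrier.\<close>

definition well :: "real \<Rightarrow> 'a set" where
  "well c = connected_component_set {z. W z < c} 0"

lemma open_well: "open (well c)"
proof -
  have "open {z. W z < c}"
    by (intro open_Collect_less W_cont continuous_on_const)
  then show ?thesis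
    unfolding well_def by (rule open_connected_component)
qed

lemma connected_well: "connected (well c)"
  by (simp add: well_def)

lemma zero_in_well: "0 < c \<Longrightarrow> 0 \<in> well c"
  by (simp add: well_def W_zero connected_component_refl)

lemma well_D: "z \<in> well c \<Longrightarrow> W z < c"
  unfolding well_def using connected_component_in by fastforce

lemma subset_well:
  assumes "connected P" "0 \<in> P" "\<And>z. z \<in> P \<Longrightarrow> W z < c"
  shows "P \<subseteq> well c"
  unfolding well_def using assms by (intro connected_component_maximal) auto

lemma well_mono: "c \<le> c' \<Longrightarrow> well c \<subseteq> well c'"
  unfolding well_def by (rule connected_component_mono) auto

lemma bounded_well_small:
  assumes e: "0 < e" and pos: "\<And>z. norm z \<le> e \<Longrightarrow> z \<noteq> 0 \<Longrightarrow> 0 < W z"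
  obtains c where "0 < c" "bounded (well c)"
proof -
  have "sphere (0::'a) e \<noteq> {}"
    using e by simp
  then obtain p where p: "p \<in> sphere 0 e" "\<And>z. z \<in> sphere 0 e \<Longrightarrow> W p \<le> W z"
    using continuous_attains_inf[OF compact_sphere _ W_cont] by blast
  have c: "0 < W p"
    using p(1) e by (intro pos) auto
  have "well (W p) \<subseteq> ball 0 e"
  proof (rule ccontr)
    assume "\<not> well (W p) \<subseteq> ball 0 e"
    then have "well (W p) \<inter> frontier (ball 0 e) \<noteq> {}"
      using zero_in_well[OF c] e by (intro connected_Int_frontier connected_well) auto
    then obtain z where "z \<in> well (W p)" "z \<in> sphere 0 e"
      unfolding frontier_ball[OF e] by blast
    then show False
      using well_D p(2) by fastforce
  qed
  then show thesis
    using c that bounded_subset[OF bounded_ball] by blast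
qed

text \<open>A mountain pass argument. If the well at level \<open>c\<close> sits in a ball but all higher wells are
  unbounded, then a connected set \<open>P\<close> at level slightly above \<open>c\<close> joins the origin to a bigger
  sphere. Moving its points by \<open>x \<mapsto> x + s F(x)\<close> fixes the origin, moves the other end so little
  that it stays outside the well, and should lower \<open>W\<close> below \<open>c\<close>; as the image is connected, it
  must fail to do so at some point. As \<open>s\<close> tends to \<open>0\<close>, these points accumulate at a point of
  level at least \<open>c\<close> at which \<open>W\<close> does not decrease along \<open>F\<close>, which contradicts dissipation.\<close>

lemma bounded_well_step:
  assumes F0: "F 0 = 0" and c: "0 < c" and bdd: "bounded (well c)"
  obtains c' where "c < c'" "bounded (well c')"
proof (rule ccontr)
  assume "\<not> thesis"
  then have unbdd: "\<not> bounded (well c')" if "c < c'" for c'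
    using that \<open>\<And>c'. c < c' \<Longrightarrow> bounded (well c') \<Longrightarrow> thesis\<close> by blast
  obtain r where r: "0 < r" "well c \<subseteq> ball 0 r"
    using bounded_subset_ballD[OF bdd, of 0] by blast
  obtain M0 where M0: "\<And>z. z \<in> cball 0 (r + 1) \<Longrightarrow> norm (F z) \<le> M0"
    using continuous_on_compact_norm_bound[OF compact_cball continuous_on_subset[OF F_cont]] by blast
  define M where "M = max M0 0 + 1"
  have M: "0 < M" "\<And>z. z \<in> cball 0 (r + 1) \<Longrightarrow> norm (F z) < M"
    using M0 by (force simp: M_def)+
  \<comment> \<open>With \<open>M\<close> bounding the speed, no point of the ball moves by more than \<open>1\<close>.\<close>
  define s where "s = (\<lambda>n. inverse (real (Suc n)) / M)"
  have s_pos: "0 < s n" for n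
    using M by (simp add: s_def)
  have sM: "s n * M \<le> 1" for n
    using M by (simp add: s_def inverse_le_1_iff)
  have s_lim: "s \<longlonglongrightarrow> 0"
    unfolding s_def using tendsto_divide_zero[OF LIMSEQ_inverse_real_of_nat] by blast
  have "\<exists>x \<tau>. x \<in> cball 0 (r + 1) \<and> 0 < \<tau> \<and> \<tau> < s n \<and> c \<le> W (x + s n *\<^sub>R F x) \<and>
      - s n \<le> gradient W (x + \<tau> *\<^sub>R F x) \<bullet> F x" for n
  proof -
    \<comment> \<open>The excess over \<open>c\<close> must vanish faster than the step \<open>s n\<close>: a failed descent then has slope
      at least \<open>- s n\<close>.\<close>
    define c' where "c' = c + (s n)\<^sup>2"
    have c': "c < c'" "0 < c'"
      using s_pos[of n] c by (auto simp: c'_def add_pos_pos)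
    obtain p where p: "p \<in> well c'" "r + 1 \<le> norm p"
      using unbdd[OF c'(1)] unfolding bounded_iff by (meson linear)
    obtain P z where P: "connected P" "P \<subseteq> well c'" "P \<subseteq> cball 0 (r + 1)" "0 \<in> P"
      and z: "z \<in> P" "norm z = r + 1"
      using open_connected_exit_continuum[OF open_well connected_well zero_in_well[OF c'(2)] p] r(1)
      by (metis add_pos_pos zero_less_one)
    define \<phi> where "\<phi> = (\<lambda>x. x + s n *\<^sub>R F x)"
    have "connected (\<phi> ` P)"
      unfolding \<phi>_def
      by (intro connected_continuous_image P continuous_intros continuous_on_subset[OF F_cont]) auto
    moreover have "0 \<in> \<phi> ` P"
      using P(4) F0 by (force simp: \<phi>_def)
    ultimately have "\<phi> ` P \<subseteq> well c" if "\<And>z. z \<in> \<phi> ` P \<Longrightarrow> W z < c"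
      using that by (rule subset_well)
    moreover have "\<not> \<phi> ` P \<subseteq> well c"
    proof
      assume "\<phi> ` P \<subseteq> well c"
      then have "\<phi> z \<in> ball 0 r"
        using r(2) z(1) by blast
      then have "norm (\<phi> z) < r"
        by simp
      moreover have "norm (s n *\<^sub>R F z) \<le> 1"
      proof -
        have "norm (s n *\<^sub>R F z) \<le> s n * M"
          using M(2)[of z] z s_pos[of n] by simp
        then show ?thesis
          using sM[of n] by linarith
      qed
      moreover have "norm z \<le> norm (\<phi> z) + norm (s n *\<^sub>R F z)"
        using norm_triangle_ineq4[of "\<phi> z" "s n *\<^sub>R F z"] by (simp add: \<phi>_def)
      ultimately show False
        using z by linarith
    qed
    ultimately obtain x where x: "x \<in> P" "c \<le> W (\<phi> x)"
      by (force simp: not_less)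
    obtain \<tau> where \<tau>: "0 < \<tau>" "\<tau> < s n"
        "W (x + s n *\<^sub>R F x) - W x = s n * (gradient W (x + \<tau> *\<^sub>R F x) \<bullet> F x)"
      using C1_mean_value[OF W_C1 s_pos] by blast
    have "W x < c + (s n)\<^sup>2"
      using well_D P(2) x(1) by (auto simp: c'_def)
    then have "s n * (- s n) \<le> s n * (gradient W (x + \<tau> *\<^sub>R F x) \<bullet> F x)"
      using x(2) \<tau>(3) by (simp add: \<phi>_def power2_eq_square)
    then have "- s n \<le> gradient W (x + \<tau> *\<^sub>R F x) \<bullet> F x"
      using s_pos[of n] by (simp only: mult_le_cancel_left_pos)
    then show ?thesis
      using x P(3) \<tau> unfolding \<phi>_def by blast
  qed
  then obtain X \<tau> where X: "\<And>n. X n \<in> cball 0 (r + 1)" and \<tau>: "\<And>n. 0 < \<tau> n" "\<And>n. \<tau> n < s n"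
    and high: "\<And>n. c \<le> W (X n + s n *\<^sub>R F (X n))"
    and slope: "\<And>n. - s n \<le> gradient W (X n + \<tau> n *\<^sub>R F (X n)) \<bullet> F (X n)"
    by metis
  obtain x k where k: "strict_mono (k :: nat \<Rightarrow> nat)" and x: "(X \<circ> k) \<longlonglongrightarrow> x"
    using compact_cball[of 0 "r + 1"] X unfolding compact_def by blast
  have x: "(\<lambda>n. X (k n)) \<longlonglongrightarrow> x"
    using x by (simp add: comp_def)
  have sk: "(\<lambda>n. s (k n)) \<longlonglongrightarrow> 0"
    using LIMSEQ_subseq_LIMSEQ[OF s_lim k] by (simp add: comp_def)
  have \<tau>k: "(\<lambda>n. \<tau> (k n)) \<longlonglongrightarrow> 0"
    by (rule tendsto_sandwich[OF _ _ tendsto_const sk])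
      (auto intro!: always_eventually less_imp_le \<tau>)
  have cont: "isCont W z" "isCont (gradient W) z" "isCont F z" for z
    using W_C1 W_cont[of UNIV] F_cont by (auto simp: C1_def continuous_on_eq_continuous_at)
  have Fx: "(\<lambda>n. F (X (k n))) \<longlonglongrightarrow> F x"
    by (rule isCont_tendsto_compose[OF cont(3) x])
  have "(\<lambda>n. W (X (k n) + s (k n) *\<^sub>R F (X (k n)))) \<longlonglongrightarrow> W (x + 0 *\<^sub>R F x)"
    by (intro isCont_tendsto_compose[OF cont(1)] tendsto_intros x sk Fx)
  then have "c \<le> W x"
    using high by (intro LIMSEQ_le_const[where X = "\<lambda>n. W (X (k n) + s (k n) *\<^sub>R F (X (k n)))"]) auto
  then have "x \<noteq> 0"
    using c W_zero by auto
  have "(\<lambda>n. gradient W (X (k n) + \<tau> (k n) *\<^sub>R F (X (k n))) \<bullet> F (X (k n)))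
      \<longlonglongrightarrow> gradient W (x + 0 *\<^sub>R F x) \<bullet> F x"
    by (intro tendsto_inner isCont_tendsto_compose[OF cont(2)] tendsto_intros x \<tau>k Fx)
  moreover have "(\<lambda>n. - s (k n)) \<longlonglongrightarrow> - 0"
    by (intro tendsto_intros sk)
  ultimately have "- 0 \<le> gradient W (x + 0 *\<^sub>R F x) \<bullet> F x"
    using slope by (intro LIMSEQ_le[where X = "\<lambda>n. - s (k n)"]) auto
  then show False
    using dissipates[of x] q_pos[OF \<open>x \<noteq> 0\<close>] by simp
qed

text \<open>Applied to paths, this exhibits a well as the union of all lower wells.\<close>

lemma compact_connected_subset_lower_well:
  assumes P: "compact P" "connected P" "0 \<in> P" and c: "\<And>z. z \<in> P \<Longrightarrow> W z < c"
  obtains b where "b < c" "\<And>b'. b < b' \<Longrightarrow> P \<subseteq> well b'"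
proof -
  obtain p where p: "p \<in> P" "\<And>z. z \<in> P \<Longrightarrow> W z \<le> W p"
    using continuous_attains_sup[OF P(1) _ W_cont] P(3) by blast
  show thesis
  proof
    show "W p < c"
      using c p(1) .
    show "P \<subseteq> well b'" if "W p < b'" for b'
      using p(2) that by (intro subset_well P) force
  qed
qed

text \<open>On a bounded well, each point starts a trajectory of cost at most \<open>W\<close>, so \<open>V \<le> W\<close> there, and
  the well lies in a sublevel set of \<open>V\<close>. This bound does not degenerate as the level grows: at
  the supremum of the levels of bounded wells the well is still bounded, and then a higher one is
  bounded as well. Hence all wells are bounded. Every point is in some well, because \<open>W\<close> is
  bounded on the segment that joins it to the origin.\<close>

theorem le_W_of_le_trajectory_cost:
  assumes F0: "F 0 = 0"
    and e: "0 < e" and pos: "\<And>z. norm z \<le> e \<Longrightarrow> z \<noteq> 0 \<Longrightarrow> 0 < W z"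
    and V_bdd: "\<And>c. bounded {z. V z \<le> c}"
    and V_le: "\<And>x y B. trajectory F x {0..} y \<Longrightarrow>
      (\<And>T. 0 \<le> T \<Longrightarrow> integral {0..T} (\<lambda>t. q (y t)) \<le> B) \<Longrightarrow> V x \<le> B"
  shows "V x \<le> W x"
proof -
  have le: "V x \<le> W x" if bdd: "bounded (well c)" and x: "x \<in> well c" for c x
  proof -
    have "gradient W z \<bullet> F z \<le> 0" for z
      using dissipates[of z] q_nonneg[of z] by linarith
    then obtain y where y: "trajectory F x {0..} y" "\<And>t. 0 \<le> t \<Longrightarrow> y t \<in> well c"
      using trajectory_in_sublevel_component[OF F_cont W_C1] bdd x unfolding well_def by blast
    have "compact (closure (well c))"
      using bdd by (simp add: compact_closure)
    moreover have "y t \<in> closure (well c)" if "0 \<le> t" for t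
      using y(2)[OF that] closure_subset by blast
    ultimately show ?thesis
      by (intro V_le[OF y(1)] integral_q_le[OF y(1)])
  qed
  have all_bounded: "bounded (well c)" for c
  proof (rule ccontr)
    assume c: "\<not> bounded (well c)"
    define S where "S = {b. bounded (well b)}"
    obtain c0 where c0: "0 < c0" "c0 \<in> S"
      using bounded_well_small[OF e pos] unfolding S_def by blast
    have ub: "b \<le> c" if "b \<in> S" for b
    proof (rule ccontr)
      assume "\<not> b \<le> c"
      then have "well c \<subseteq> well b"
        by (intro well_mono) simp
      then show False
        using that c unfolding S_def by (auto dest: bounded_subset)
    qed
    have S: "bdd_above S" "S \<noteq> {}"
      using c0(2) by (auto intro!: bdd_aboveI[of S c] ub)
    have Sup_pos: "0 < Sup S"
      using cSup_upper[OF c0(2) S(1)] c0(1) by linarith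
    have "well (Sup S) \<subseteq> {z. V z \<le> Sup S}"
    proof clarsimp
      fix x assume x: "x \<in> well (Sup S)"
      have "path_connected (well (Sup S))"
        using connected_open_path_connected[OF open_well connected_well] .
      then obtain g where g: "path g" "path_image g \<subseteq> well (Sup S)" "pathstart g = 0" "pathfinish g = x"
        using zero_in_well[OF Sup_pos] x unfolding path_connected_def by blast
      have ends: "0 \<in> path_image g" "x \<in> path_image g"
        using g(3,4) by (metis pathstart_in_path_image, metis pathfinish_in_path_image)
      obtain b where b: "b < Sup S" "\<And>b'. b < b' \<Longrightarrow> path_image g \<subseteq> well b'"
        using compact_connected_subset_lower_well[OF compact_path_image[OF g(1)]
            connected_path_image[OF g(1)] ends(1)] g(2) well_D by blast
      obtain b' where "b' \<in> S" "b < b'"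
        using b(1) less_cSup_iff[OF S(2,1)] by blast
      then have "V x \<le> W x"
        using b(2) ends le unfolding S_def by blast
      then show "V x \<le> Sup S"
        using well_D[OF x] by linarith
    qed
    then have "bounded (well (Sup S))"
      using V_bdd bounded_subset by blast
    then obtain c' where "Sup S < c'" "c' \<in> S"
      using bounded_well_step[OF F0 Sup_pos] unfolding S_def by blast
    then show False
      using cSup_upper[OF _ S(1), of c'] by linarith
  qed
  obtain p where p: "\<And>z. z \<in> closed_segment 0 x \<Longrightarrow> W z \<le> W p"
    using continuous_attains_sup[OF compact_segment _ W_cont, of 0 x] by blast
  have "closed_segment 0 x \<subseteq> well (W p + 1)"
    using p by (intro subset_well connected_segment) force+
  then show ?thesis
    using le[OF all_bounded] by blast
qed

context
  assumes W_nonneg: "\<And>z. 0 \<le> W z" and W_coercive: "\<And>c. bounded {z. W z \<le> c}"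
begin

lemma compact_sublevel: "compact {z. W z \<le> c}"
  using W_coercive closed_Collect_le[OF W_cont continuous_on_const]
  by (simp add: compact_eq_bounded_closed)

lemma trajectory_exists: "\<exists>y. trajectory F x {0..} y"
proof -
  let ?C = "connected_component_set {z. W z < W x + 1} x"
  have "?C \<subseteq> {z. W z \<le> W x + 1}"
    using connected_component_subset by fastforce
  then have "bounded ?C"
    using W_coercive bounded_subset by blast
  moreover have "x \<in> ?C"
    by (simp add: connected_component_refl)
  moreover have "gradient W z \<bullet> F z \<le> 0" for z
    using dissipates[of z] q_nonneg[of z] by linarith
  ultimately show ?thesis
    using trajectory_in_sublevel_component[OF F_cont W_C1] by blast
qed

lemma trajectory_below:
  assumes y: "trajectory F x I y" and t: "{0..t} \<subseteq> I" "0 \<le> t"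
  shows "y t \<in> {z. W z \<le> W x}"
proof -
  have "gradient W z \<bullet> F z \<le> - 0" for z
    using dissipates[of z] q_nonneg[of z] by linarith
  from trajectory_energy_le[OF W_C1 y t continuous_on_const this] show ?thesis
    using y by (simp add: trajectory_def)
qed

lemma local_trajectory_extends:
  assumes "0 < T" "trajectory F x {0..<T} y"
  obtains z where "trajectory F x {0..} z" "\<And>t. t \<in> {0..<T} \<Longrightarrow> z t = y t"
proof (rule trajectory_extend[OF F_cont assms compact_sublevel[of "W x"] _ trajectory_exists])
  show "y t \<in> {z. W z \<le> W x}" if "t \<in> {0..<T}" for t
    by (rule trajectory_below[OF assms(2)]) (use that in auto)
qed (rule that)

lemma coercive_trajectory:
  assumes "trajectory F x {0..} y"
  shows "(y \<longlongrightarrow> 0) at_top" "0 \<le> T \<Longrightarrow> integral {0..T} (\<lambda>t. q (y t)) \<le> W x"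
proof -
  have K: "y t \<in> {z. W z \<le> W x}" if "0 \<le> t" for t
    by (rule trajectory_below[OF assms]) (use that in auto)
  show "(y \<longlongrightarrow> 0) at_top"
    using W_pos_of_nonneg[OF open_UNIV] W_nonneg
    by (intro trajectory_tendsto_0[OF assms compact_sublevel K]) auto
  show "integral {0..T} (\<lambda>t. q (y t)) \<le> W x" if "0 \<le> T"
    by (rule integral_q_le[OF assms compact_sublevel K that])
qed

end

end

section \<open>The weighted projection\<close>

context
  fixes R :: "real^'m^'m"
  assumes R: "sym_pos_def R"
begin

lemma weighted_inner_commute: "x \<bullet> (R *v y) = y \<bullet> (R *v x)"
  using R dot_lmul_matrix[of x R y] by (simp add: sym_pos_def_def inner_commute flip: transpose_matrix_vector)

lemma wnorm_sq_nonneg: "0 \<le> wnorm_sq R x"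
  using R by (cases "x = 0") (auto simp: sym_pos_def_def wnorm_sq_def less_imp_le)

lemma weighted_inner_nonpos_imp_zero:
  assumes "x \<bullet> (R *v x) \<le> 0"
  shows "x = 0"
  using R assms unfolding sym_pos_def_def by (auto simp: not_less[symmetric])

lemma wnorm_sq_add_scaled:
  "wnorm_sq R (x + t *\<^sub>R v) = wnorm_sq R x + 2 * t * (v \<bullet> (R *v x)) + t\<^sup>2 * wnorm_sq R v"
  using weighted_inner_commute[of x v]
  by (simp add: wnorm_sq_def algebra_simps inner_simps matrix_vector_right_distrib power2_eq_square)

lemma wnorm_sq_coercive:
  obtains k where "0 < k" "\<And>x. k * (norm x)\<^sup>2 \<le> wnorm_sq R x"
proof -
  have cont: "continuous_on S (wnorm_sq R)" for S
    unfolding wnorm_sq_def by (intro continuous_intros)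
  have "sphere (0::real^'m) 1 \<noteq> {}"
    by simp
  then obtain p where p: "p \<in> sphere 0 1" "\<And>z. z \<in> sphere 0 1 \<Longrightarrow> wnorm_sq R p \<le> wnorm_sq R z"
    using continuous_attains_inf[OF compact_sphere _ cont] by blast
  have "p \<noteq> 0"
    using p(1) by auto
  then have "0 < wnorm_sq R p"
    using R by (simp add: sym_pos_def_def wnorm_sq_def)
  moreover have "wnorm_sq R p * (norm x)\<^sup>2 \<le> wnorm_sq R x" for x
  proof (cases "x = 0")
    case False
    then have "wnorm_sq R p \<le> wnorm_sq R ((1 / norm x) *\<^sub>R x)"
      by (intro p(2)) simp
    also have "\<dots> = wnorm_sq R x / (norm x)\<^sup>2"
      by (simp add: wnorm_sq_def matrix_vector_mult_scaleR power2_eq_square)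
    finally show ?thesis
      using False by (simp add: field_simps)
  qed (simp add: wnorm_sq_def)
  ultimately show thesis
    using that by blast
qed

lemma matrix_mult_inv_vector: "R *v (matrix_inv R *v b) = b"
proof -
  have "\<forall>x. R *v x = 0 \<longrightarrow> x = 0"
    using weighted_inner_nonpos_imp_zero by simp
  then have "invertible R"
    by (simp add: invertible_left_inverse matrix_left_invertible_ker)
  then have "R ** matrix_inv R = mat 1"
    unfolding invertible_def matrix_inv_def by (rule someI_ex[THEN conjunct1])
  then show ?thesis
    by (simp add: matrix_vector_mul_assoc)
qed

context
  fixes U :: "(real^'m) set"
  assumes U: "closed U" "convex U" "U \<noteq> {}"
begin

lemma weighted_closest_point_exists: "\<exists>p\<in>U. \<forall>q\<in>U. wnorm_sq R (z - p) \<le> wnorm_sq R (z - q)"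
proof -
  obtain a where a: "a \<in> U"
    using U by blast
  obtain k where k: "0 < k" "\<And>x. k * (norm x)\<^sup>2 \<le> wnorm_sq R x"
    using wnorm_sq_coercive by blast
  have cont: "continuous_on S (\<lambda>q. wnorm_sq R (z - q))" for S
    unfolding wnorm_sq_def by (intro continuous_intros continuous_on_compose2[OF matrix_vector_mult_linear_continuous_on[of UNIV R]]) auto
  define B where "B = wnorm_sq R (z - a) / k + 1"
  define K where "K = U \<inter> {q. wnorm_sq R (z - q) \<le> wnorm_sq R (z - a)}"
  have "norm (z - q) \<le> B" if "q \<in> K" for q
  proof -
    have "k * (norm (z - q))\<^sup>2 \<le> wnorm_sq R (z - a)"
      using k(2)[of "z - q"] that by (simp add: K_def)
    then have "(norm (z - q))\<^sup>2 + 1 \<le> B"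
      using k(1) by (simp add: B_def field_simps)
    moreover have "2 * norm (z - q) \<le> (norm (z - q))\<^sup>2 + 1"
      using zero_le_power2[of "norm (z - q) - 1"] unfolding power2_diff by simp
    ultimately show ?thesis
      using norm_ge_zero[of "z - q"] by linarith
  qed
  then have "K \<subseteq> cball z B"
    by (auto simp: dist_norm)
  then have "bounded K"
    by (rule bounded_subset[OF bounded_cball])
  moreover have "closed K"
    unfolding K_def by (intro closed_Int U(1) closed_Collect_le cont continuous_on_const)
  ultimately have "compact K"
    by (simp add: compact_eq_bounded_closed)
  moreover have "a \<in> K"
    using a by (simp add: K_def)
  ultimately obtain p where "p \<in> K" "\<forall>q\<in>K. wnorm_sq R (z - p) \<le> wnorm_sq R (z - q)"
    using continuous_attains_inf[of K "\<lambda>q. wnorm_sq R (z - q)", OF _ _ cont] by auto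
  then have p: "p \<in> K" "\<And>q. q \<in> K \<Longrightarrow> wnorm_sq R (z - p) \<le> wnorm_sq R (z - q)"
    by simp_all
  show ?thesis
  proof (intro bexI ballI)
    show "p \<in> U"
      using p by (simp add: K_def)
    show "wnorm_sq R (z - p) \<le> wnorm_sq R (z - q)" if "q \<in> U" for q
      using p(1) p(2)[of q] that by (cases "q \<in> K") (auto simp: K_def)
  qed
qed

text \<open>First-order optimality: moving from \<open>p\<close> a little towards \<open>q\<close> must not reduce the distance.\<close>

lemma weighted_closest_point_variational:
  assumes p: "p \<in> U" "\<And>q. q \<in> U \<Longrightarrow> wnorm_sq R (z - p) \<le> wnorm_sq R (z - q)" and q: "q \<in> U"
  shows "(q - p) \<bullet> (R *v (z - p)) \<le> 0"
proof (rule ccontr)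
  define a where "a = (q - p) \<bullet> (R *v (z - p))"
  define b where "b = wnorm_sq R (q - p)"
  assume "\<not> (q - p) \<bullet> (R *v (z - p)) \<le> 0"
  then have a: "0 < a"
    by (simp add: a_def)
  have b: "0 \<le> b"
    by (simp add: b_def wnorm_sq_nonneg)
  \<comment> \<open>Small enough for the linear term of the expansion to dominate the quadratic one.\<close>
  define t where "t = min 1 (a / (b + 1))"
  have t: "0 < t" "t \<le> 1" "t \<le> a / (b + 1)"
    using a b by (auto simp: t_def)
  have tb: "t * (b + 1) \<le> a"
    using t(3) b by (simp add: pos_le_divide_eq)
  have "p + t *\<^sub>R (q - p) = (1 - t) *\<^sub>R p + t *\<^sub>R q"
    by (simp add: algebra_simps)
  then have "p + t *\<^sub>R (q - p) \<in> U"
    using U(2) p(1) q t unfolding convex_def by simp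
  then have "wnorm_sq R (z - p) \<le> wnorm_sq R (z - (p + t *\<^sub>R (q - p)))"
    by (rule p(2))
  also have "z - (p + t *\<^sub>R (q - p)) = (z - p) + (- t) *\<^sub>R (q - p)"
    by (simp add: algebra_simps)
  also have "wnorm_sq R \<dots> = wnorm_sq R (z - p) - 2 * t * a + t\<^sup>2 * b"
    using wnorm_sq_add_scaled[of "z - p" "- t" "q - p"] by (simp add: a_def b_def)
  finally have "t * (2 * a) \<le> t * (t * b)"
    by (simp add: power2_eq_square algebra_simps)
  then have "2 * a \<le> t * b"
    using t(1) by simp
  then show False
    using t(1) tb a by (simp add: algebra_simps)
qed

lemma wproj_unique_minimizer:
  "\<exists>!p. p \<in> U \<and> (\<forall>q\<in>U. wnorm_sq R (z - p) \<le> wnorm_sq R (z - q))"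
proof (rule ex_ex1I)
  show "\<exists>p. p \<in> U \<and> (\<forall>q\<in>U. wnorm_sq R (z - p) \<le> wnorm_sq R (z - q))"
    using weighted_closest_point_exists by blast
  fix p p'
  assume p: "p \<in> U \<and> (\<forall>q\<in>U. wnorm_sq R (z - p) \<le> wnorm_sq R (z - q))"
    and p': "p' \<in> U \<and> (\<forall>q\<in>U. wnorm_sq R (z - p') \<le> wnorm_sq R (z - q))"
  have "(p' - p) \<bullet> (R *v (z - p)) \<le> 0"
    by (rule weighted_closest_point_variational) (use p p' in auto)
  moreover have "(p - p') \<bullet> (R *v (z - p')) \<le> 0"
    by (rule weighted_closest_point_variational) (use p p' in auto)
  ultimately have "(p' - p) \<bullet> (R *v (p' - p)) \<le> 0"
    by (simp add: inner_simps algebra_simps matrix_vector_mult_diff_distrib)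
  then show "p = p'"
    using weighted_inner_nonpos_imp_zero[of "p' - p"] by simp
qed

lemma wproj_minimizer:
  shows wproj_in: "wproj R U z \<in> U"
    and wproj_variational: "q \<in> U \<Longrightarrow> (q - wproj R U z) \<bullet> (R *v (z - wproj R U z)) \<le> 0"
proof -
  have min: "wproj R U z \<in> U \<and> (\<forall>q\<in>U. wnorm_sq R (z - wproj R U z) \<le> wnorm_sq R (z - q))"
    unfolding wproj_def by (rule theI'[OF wproj_unique_minimizer[of z]])
  then show "wproj R U z \<in> U"
    by blast
  show "q \<in> U \<Longrightarrow> (q - wproj R U z) \<bullet> (R *v (z - wproj R U z)) \<le> 0"
    using min by (intro weighted_closest_point_variational) auto
qed

lemma wproj_of_member:
  assumes "z \<in> U"
  shows "wproj R U z = z"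
  using weighted_inner_nonpos_imp_zero[OF wproj_variational[OF assms, of z]] by simp

text \<open>Adding the variational inequalities at two projected points shows that the projection is
  even Lipschitz.\<close>

lemma continuous_on_wproj: "continuous_on S (wproj R U)"
proof -
  obtain k where k: "0 < k" "\<And>x. k * (norm x)\<^sup>2 \<le> wnorm_sq R x"
    using wnorm_sq_coercive by blast
  have "bounded_linear ((*v) R)"
    by (rule matrix_vector_mul_bounded_linear)
  then obtain B where B: "0 \<le> B" "\<And>x. norm (R *v x) \<le> norm x * B"
    using bounded_linear.nonneg_bounded by blast
  have "(B / k)-lipschitz_on UNIV (wproj R U)"
  proof (rule lipschitz_onI)
    fix z z'
    define p p' where "p = wproj R U z" and "p' = wproj R U z'"
    have "(p' - p) \<bullet> (R *v (z - p)) \<le> 0" "(p - p') \<bullet> (R *v (z' - p')) \<le> 0"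
      unfolding p_def p'_def by (intro wproj_variational wproj_in)+
    then have "wnorm_sq R (p' - p) \<le> (p' - p) \<bullet> (R *v (z' - z))"
      by (simp add: wnorm_sq_def inner_simps algebra_simps matrix_vector_mult_diff_distrib)
    also have "\<dots> \<le> norm (p' - p) * norm (R *v (z' - z))"
      by (rule norm_cauchy_schwarz)
    also have "\<dots> \<le> norm (p' - p) * (norm (z' - z) * B)"
      by (intro mult_left_mono B) simp
    finally have "norm (p' - p) * (k * norm (p' - p)) \<le> norm (p' - p) * (norm (z' - z) * B)"
      using k(2)[of "p' - p"] by (simp add: power2_eq_square algebra_simps)
    then have "k * norm (p' - p) \<le> norm (z' - z) * B"
      using B(1) by (cases "p' = p") auto
    then show "dist (wproj R U z) (wproj R U z') \<le> B / k * dist z z'"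
      using k(1) by (simp add: dist_norm norm_minus_commute p_def p'_def field_simps)
  qed (use B k in auto)
  then show ?thesis
    using lipschitz_on_continuous_on continuous_on_subset by blast
qed

text \<open>Completing the square, the Hamiltonian \<open>v \<mapsto> D \<bullet> (G *v v) + wnorm_sq R v\<close> is the weighted
  squared distance of \<open>v\<close> to its unconstrained minimizer, up to a constant.\<close>

lemma wproj_minimizes_hamiltonian:
  fixes G :: "real^'m^'d"
  assumes v: "v \<in> U"
    and p: "p = wproj R U (- (1/2) *\<^sub>R (matrix_inv R *v (transpose G *v D)))"
  shows "D \<bullet> (G *v p) + wnorm_sq R p \<le> D \<bullet> (G *v v) + wnorm_sq R v"
proof -
  define z where "z = - (1/2) *\<^sub>R (matrix_inv R *v (transpose G *v D))"
  have Rz: "R *v z = - (1/2) *\<^sub>R (transpose G *v D)"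
    unfolding z_def matrix_vector_mult_scaleR matrix_mult_inv_vector ..
  have DG: "D \<bullet> (G *v w) = - 2 * (w \<bullet> (R *v z))" for w
    unfolding Rz using dot_lmul_matrix[of D G w] by (simp add: inner_commute)
  have "(v - p) \<bullet> (R *v (z - p)) \<le> 0"
    unfolding p z_def[symmetric] by (rule wproj_variational[OF v])
  moreover have "0 \<le> wnorm_sq R (v - p)"
    by (rule wnorm_sq_nonneg)
  ultimately show ?thesis
    using weighted_inner_commute[of p v]
    by (simp add: DG wnorm_sq_def inner_simps algebra_simps matrix_vector_mult_diff_distrib)
qed

end

end

section \<open>Policy iteration\<close>

locale control_problem =
  fixes f :: "real^'d \<Rightarrow> real^'d" and g :: "real^'d \<Rightarrow> real^'m^'d" and l :: "real^'d \<Rightarrow> real"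
    and R :: "real^'m^'m" and U :: "(real^'m) set" and \<Omega> :: "(real^'d) set"
    and V :: "real^'d \<Rightarrow> real"
  assumes \<Omega>: "open \<Omega>" "0 \<in> \<Omega>"
    and U: "closed U" "convex U" "0 \<in> U"
    and R: "sym_pos_def R"
    and cont: "continuous_on UNIV f" "continuous_on UNIV g" "continuous_on UNIV l"
    and f_0: "f 0 = 0" and l_0: "l 0 = 0" and l_pos: "\<And>y. y \<noteq> 0 \<Longrightarrow> 0 < l y"
    and V_value: "\<And>x. 0 \<le> V x \<and> ennreal (V x) = optimal_value f g l R U x"
    and V_unbounded: "filterlim V at_top at_infinity"
begin

definition vector_field :: "(real^'d \<Rightarrow> real^'m) \<Rightarrow> real^'d \<Rightarrow> real^'d" where
  "vector_field u x = f x + g x *v u x"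

definition running_cost :: "(real^'d \<Rightarrow> real^'m) \<Rightarrow> real^'d \<Rightarrow> real" where
  "running_cost u x = l x + wnorm_sq R (u x)"

definition feedback :: "(real^'d \<Rightarrow> real^'m) \<Rightarrow> bool" where
  "feedback u \<longleftrightarrow> continuous_on UNIV u \<and> u 0 = 0 \<and> (\<forall>x. u x \<in> U)"

lemma closed_loop_eq: "closed_loop f g u = trajectory (vector_field u)"
  by (intro ext) (simp add: closed_loop_def trajectory_def vector_field_def)

lemma bounded_V_sublevel: "bounded {x. V x \<le> c}"
proof -
  have "\<forall>\<^sub>F x in at_infinity. c + 1 \<le> V x"
    using V_unbounded unfolding filterlim_at_top by blast
  then obtain b where "\<And>x. b \<le> norm x \<Longrightarrow> c + 1 \<le> V x"
    unfolding eventually_at_infinity by blast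
  then have "norm x \<le> b" if "V x \<le> c" for x
    using that by (smt (verit))
  then show ?thesis
    unfolding bounded_iff by blast
qed

lemma continuous_on_matrix_vector_mult:
  fixes A :: "real^'d \<Rightarrow> real^'a^'b"
  assumes "continuous_on S A" "continuous_on S v"
  shows "continuous_on S (\<lambda>x. A x *v v x)"
  unfolding matrix_vector_mult_def by (intro continuous_intros assms)

lemma feedback_dissipation:
  assumes u: "feedback u" and W: "C1 W" "W 0 = 0"
    and le: "\<And>x. gradient W x \<bullet> vector_field u x \<le> - running_cost u x"
  shows "dissipation (vector_field u) W (running_cost u)"
proof
  show "continuous_on UNIV (vector_field u)"
    unfolding vector_field_def using u cont
    by (intro continuous_on_add continuous_on_matrix_vector_mult) (auto simp: feedback_def)
  show "continuous_on UNIV (running_cost u)"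
    unfolding running_cost_def wnorm_sq_def using u cont
    by (intro continuous_on_add continuous_on_inner continuous_on_matrix_vector_mult)
      (auto simp: feedback_def)
  show pos: "0 < running_cost u z" if "z \<noteq> 0" for z
    using l_pos[OF that] wnorm_sq_nonneg[OF R, of "u z"] by (simp add: running_cost_def)
  show "0 \<le> running_cost u z" for z
    using pos[of z] l_0 wnorm_sq_nonneg[OF R, of "u 0"]
    by (cases "z = 0") (auto simp: running_cost_def)
qed (use W le in auto)

lemma feedback_control_pair:
  assumes u: "feedback u" and y: "trajectory (vector_field u) x {0..} y"
  shows "control_pair f g U x (\<lambda>t. u (y t)) y"
  unfolding control_pair_def
proof (intro conjI allI impI)
  have u_cont: "continuous_on UNIV u"
    using u by (simp add: feedback_def)
  have field_cont: "continuous_on {0..} (\<lambda>s. vector_field u (y s))"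
    by (rule continuous_on_compose2[OF _ trajectory_continuous_on[OF y]])
      (auto simp: vector_field_def intro!: continuous_on_add continuous_on_matrix_vector_mult u_cont cont)
  have "continuous_on {0..} (\<lambda>t. u (y t))"
    by (rule continuous_on_compose2[OF u_cont trajectory_continuous_on[OF y]]) simp
  then show "(\<lambda>t. u (y t)) \<in> borel_measurable (lebesgue_on {0..})"
    by (rule continuous_imp_measurable_on_sets_lebesgue) simp
  show "u (y t) \<in> U" for t
    using u by (simp add: feedback_def)
  show "continuous_on {0..} y"
    by (rule trajectory_continuous_on[OF y])
  show start: "y 0 = x"
    using y by (simp add: trajectory_def)
  fix t :: real assume t: "0 \<le> t"
  have "(\<lambda>s. vector_field u (y s)) absolutely_integrable_on {0..t}"
    by (rule absolutely_integrable_continuous_real[OF continuous_on_subset[OF field_cont]]) auto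
  then show "(\<lambda>s. f (y s) + g (y s) *v u (y s)) absolutely_integrable_on {0..t}"
    by (simp add: vector_field_def)
  have "((\<lambda>s. vector_field u (y s)) has_integral y t - y 0) {0..t}"
    by (rule trajectory_has_integral[OF y]) (use t in auto)
  then show "((\<lambda>s. f (y s) + g (y s) *v u (y s)) has_integral y t - x) {0..t}"
    by (simp add: vector_field_def start)
qed

lemma feedback_cost_le:
  assumes u: "feedback u" and y: "trajectory (vector_field u) x {0..} y"
    and B: "\<And>T. 0 \<le> T \<Longrightarrow> integral {0..T} (\<lambda>t. running_cost u (y t)) \<le> B"
  shows "cost l R (\<lambda>t. u (y t)) y \<le> ennreal B"
proof -
  have u_cont: "continuous_on UNIV u"
    using u by (simp add: feedback_def)
  have "continuous_on UNIV (running_cost u)"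
    unfolding running_cost_def wnorm_sq_def using cont
    by (intro continuous_on_add continuous_on_inner continuous_on_matrix_vector_mult u_cont) auto
  then have "continuous_on {0..} (\<lambda>t. running_cost u (y t))"
    by (rule continuous_on_compose2[OF _ trajectory_continuous_on[OF y]]) simp
  moreover have "0 \<le> running_cost u z" for z
    using l_pos[of z] l_0 wnorm_sq_nonneg[OF R, of "u z"]
    by (cases "z = 0") (auto simp: running_cost_def)
  ultimately have "(\<integral>\<^sup>+ t. ennreal (running_cost u (y t)) \<partial>lebesgue_on {0..}) \<le> ennreal B"
    using B by (intro nn_integral_half_line_le)
  then show ?thesis
    by (simp add: cost_def running_cost_def)
qed

lemma value_le_feedback_cost:
  assumes u: "feedback u" and y: "trajectory (vector_field u) x {0..} y"
    and B: "\<And>T. 0 \<le> T \<Longrightarrow> integral {0..T} (\<lambda>t. running_cost u (y t)) \<le> B"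
  shows "V x \<le> B"
proof -
  have "ennreal (V x) = optimal_value f g l R U x"
    using V_value by blast
  also have "\<dots> \<le> cost l R (\<lambda>t. u (y t)) y"
    unfolding optimal_value_def
    by (rule INF_lower2[of "(\<lambda>t. u (y t), y)"]) (use feedback_control_pair[OF u y] in auto)
  also have "\<dots> \<le> ennreal B"
    by (rule feedback_cost_le[OF u y B])
  finally show ?thesis
    using B[of 0] by simp
qed

lemma admissible_imp_feedback: "u \<in> admissible f g l R U \<Omega> \<Longrightarrow> feedback u"
  by (simp add: admissible_def feedback_def)

lemma admissible_trajectory:
  assumes "u \<in> admissible f g l R U \<Omega>" "x \<in> \<Omega>"
  obtains y where "trajectory (vector_field u) x {0..} y" "(y \<longlongrightarrow> 0) at_top"
  using assms unfolding admissible_def globally_solvable_def closed_loop_eq by blast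

text \<open>Admissibility makes \<open>W\<close> nonnegative on \<open>\<Omega>\<close>, since the energy decreases to \<open>W 0 = 0\<close> along a
  trajectory that tends to the origin. This is the positivity near the origin that
  \<open>le_W_of_le_trajectory_cost\<close> needs in order to compare \<open>V\<close> and \<open>W\<close> everywhere.\<close>

lemma value_le_policy_value:
  assumes adm: "u \<in> admissible f g l R U \<Omega>"
    and D: "dissipation (vector_field u) W (running_cost u)"
  shows "V x \<le> W x"
proof -
  interpret dissipation "vector_field u" W "running_cost u"
    by (rule D)
  have u: "feedback u"
    by (rule admissible_imp_feedback[OF adm])
  have nonneg: "0 \<le> W x" if x: "x \<in> \<Omega>" for x
  proof -
    obtain y where y: "trajectory (vector_field u) x {0..} y" "(y \<longlongrightarrow> 0) at_top"
      using admissible_trajectory[OF adm x] by blast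
    have "isCont W 0"
      using W_cont[of UNIV] by (simp add: continuous_on_eq_continuous_at)
    then have "((\<lambda>t. W (y t)) \<longlongrightarrow> W 0) at_top"
      using y(2) by (rule isCont_tendsto_compose)
    moreover have "\<forall>\<^sub>F t in at_top. W (y t) \<le> W x"
      using energy_mono[OF y(1), of 0] y(1)
      by (auto simp: trajectory_def eventually_at_top_linorder intro!: exI[of _ 0])
    ultimately show ?thesis
      unfolding W_zero by (rule tendsto_upperbound) simp
  qed
  obtain e where e: "0 < e" "cball 0 e \<subseteq> \<Omega>"
    using \<Omega> open_contains_cball by blast
  have pos: "0 < W z" if "norm z \<le> e" "z \<noteq> 0" for z
  proof -
    have "z \<in> \<Omega>"
      using e(2) that(1) by auto
    then show ?thesis
      using that(2) by (intro W_pos_of_nonneg[OF \<Omega>(1)] nonneg)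
  qed
  show ?thesis
  proof (rule le_W_of_le_trajectory_cost[OF _ e(1) pos])
    show "vector_field u 0 = 0"
      using u f_0 by (simp add: vector_field_def feedback_def)
    show "V x \<le> B" if "trajectory (vector_field u) x {0..} y"
      "\<And>T. 0 \<le> T \<Longrightarrow> integral {0..T} (\<lambda>t. running_cost u (y t)) \<le> B" for x y B
      by (rule value_le_feedback_cost[OF u that])
  qed (simp_all add: bounded_V_sublevel)
qed

text \<open>With \<open>V \<le> W\<close> on the whole space, \<open>W\<close> inherits nonnegativity and bounded sublevel sets from
  \<open>V\<close> and becomes a global Lyapunov function, wherever trajectories may go.\<close>

lemma coercive_dissipation_imp_admissible:
  assumes u: "feedback u" and D: "dissipation (vector_field u) W (running_cost u)"
    and W: "\<And>x. V x \<le> W x"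
  shows "u \<in> admissible f g l R U \<Omega>"
proof -
  interpret dissipation "vector_field u" W "running_cost u"
    by (rule D)
  have nonneg: "0 \<le> W z" for z
    using V_value[of z] W[of z] by linarith
  have coercive: "bounded {z. W z \<le> c}" for c
    by (rule bounded_subset[OF bounded_V_sublevel[of c]]) (use W order_trans in blast)
  have "globally_solvable f g u x" for x
    unfolding globally_solvable_def closed_loop_eq
  proof (intro conjI allI impI)
    show "\<exists>y. trajectory (vector_field u) x {0..} y"
      by (rule trajectory_exists[OF nonneg coercive])
    fix T y assume "0 < T" "trajectory (vector_field u) x {0..<T} y"
    then obtain z where "trajectory (vector_field u) x {0..} z" "\<And>t. t \<in> {0..<T} \<Longrightarrow> z t = y t"
      using local_trajectory_extends[OF nonneg coercive] by blast
    then show "\<exists>z. trajectory (vector_field u) x {0..} z \<and> (\<forall>t\<in>{0..<T}. z t = y t)"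
      by blast
  qed
  moreover have "(y \<longlongrightarrow> 0) at_top" "cost l R (\<lambda>t. u (y t)) y < \<infinity>"
    if y: "trajectory (vector_field u) x {0..} y" for x y
  proof -
    show "(y \<longlongrightarrow> 0) at_top"
      by (rule coercive_trajectory(1)[OF nonneg coercive y])
    have "cost l R (\<lambda>t. u (y t)) y \<le> ennreal (W x)"
      by (rule feedback_cost_le[OF u y coercive_trajectory(2)[OF nonneg coercive y]])
    then show "cost l R (\<lambda>t. u (y t)) y < \<infinity>"
      using ennreal_less_top le_less_trans by (metis infinity_ennreal_def)
  qed
  ultimately show ?thesis
    using u unfolding admissible_def closed_loop_eq feedback_def
    by (auto intro: borel_measurable_continuous_onI)
qed

text \<open>The origin is a minimum of \<open>W\<close>, so the gradient vanishes there and the new control does,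
  too.\<close>

lemma improved_policy_feedback:
  assumes W: "C1 W" "W 0 = 0" "\<And>x. 0 \<le> W x"
    and v: "\<And>x. v x = wproj R U (- (1/2) *\<^sub>R (matrix_inv R *v (transpose (g x) *v gradient W x)))"
  shows "feedback v"
  unfolding feedback_def
proof (intro conjI allI)
  have U': "U \<noteq> {}"
    using U by blast
  have "continuous_on UNIV (gradient W)"
    using W(1) by (simp add: C1_def)
  moreover have "continuous_on UNIV (\<lambda>x. transpose (g x))"
    unfolding transpose_def by (intro continuous_intros cont)
  ultimately have "continuous_on UNIV (\<lambda>x. - (1/2) *\<^sub>R (matrix_inv R *v (transpose (g x) *v gradient W x)))"
    by (intro continuous_on_scaleR continuous_on_const continuous_on_matrix_vector_mult)
  then have "continuous_on UNIV (\<lambda>x. wproj R U (- (1/2) *\<^sub>R (matrix_inv R *v (transpose (g x) *v gradient W x))))"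
    by (rule continuous_on_compose2[OF continuous_on_wproj[OF R U(1,2) U', of UNIV]]) simp
  then show "continuous_on UNIV v"
    using v by presburger
  have "gradient W 0 = 0"
    using W by (intro C1_local_min_gradient[of W UNIV]) auto
  then show "v 0 = 0"
    using wproj_of_member[OF R U(1,2) U' U(3)] by (simp add: v)
  show "v x \<in> U" for x
    unfolding v by (rule wproj_in[OF R U(1,2) U'])
qed

text \<open>The old control makes the Hamiltonian vanish, and the new one minimizes it.\<close>

lemma improved_policy_dissipates:
  assumes u: "\<And>x. u x \<in> U"
    and eq: "\<And>x. gradient W x \<bullet> (f x + g x *v u x) + l x + wnorm_sq R (u x) = 0"
    and v: "\<And>x. v x = wproj R U (- (1/2) *\<^sub>R (matrix_inv R *v (transpose (g x) *v gradient W x)))"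
  shows "gradient W x \<bullet> vector_field v x \<le> - running_cost v x"
proof -
  have "U \<noteq> {}"
    using U by blast
  then have "gradient W x \<bullet> (g x *v v x) + wnorm_sq R (v x)
      \<le> gradient W x \<bullet> (g x *v u x) + wnorm_sq R (u x)"
    using wproj_minimizes_hamiltonian[OF R U(1,2) _ u v] by blast
  then show ?thesis
    using eq[of x] by (simp add: vector_field_def running_cost_def inner_add_right)
qed

text \<open>Along a trajectory of the new closed loop, \<open>W'\<close> decreases exactly at the rate of the running
  cost and \<open>W\<close> at least that fast; both tend to \<open>0\<close>.\<close>

lemma improved_policy_value_le:
  assumes adm: "v \<in> admissible f g l R U \<Omega>" and x: "x \<in> \<Omega>"
    and D: "dissipation (vector_field v) W (running_cost v)"
    and W': "C1 W'" "W' 0 = 0"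
    and eq: "\<And>x. gradient W' x \<bullet> vector_field v x = - running_cost v x"
  shows "W' x \<le> W x"
proof -
  interpret dissipation "vector_field v" W "running_cost v"
    by (rule D)
  obtain y where y: "trajectory (vector_field v) x {0..} y" "(y \<longlongrightarrow> 0) at_top"
    using admissible_trajectory[OF adm x] by blast
  have "W' x - W' (y t) \<le> W x - W (y t)" if t: "0 \<le> t" for t
  proof -
    have "((\<lambda>s. - running_cost v (y s)) has_integral W' (y t) - W' (y 0)) {0..t}"
      using trajectory_energy[OF W'(1) y(1), of 0 t] t eq by simp
    then have "integral {0..t} (\<lambda>s. - running_cost v (y s)) = W' (y t) - W' (y 0)"
      by (rule integral_unique)
    then show ?thesis
      using energy_le[OF y(1), of 0 t] t y(1) by (simp add: trajectory_def)
  qed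
  then have ev: "\<forall>\<^sub>F t in at_top. W' x - W' (y t) \<le> W x - W (y t)"
    by (auto simp: eventually_at_top_linorder intro!: exI[of _ 0])
  have cont_0: "isCont W 0" "isCont W' 0"
    using W_cont[of UNIV] C1_continuous_on[OF W'(1), of UNIV]
    by (simp_all add: continuous_on_eq_continuous_at)
  have lim: "((\<lambda>t. W x - W (y t)) \<longlongrightarrow> W x - W 0) at_top"
    by (rule tendsto_diff[OF tendsto_const isCont_tendsto_compose[OF cont_0(1) y(2)]])
  have lim': "((\<lambda>t. W' x - W' (y t)) \<longlongrightarrow> W' x - W' 0) at_top"
    by (rule tendsto_diff[OF tendsto_const isCont_tendsto_compose[OF cont_0(2) y(2)]])
  have "W' x - W' 0 \<le> W x - W 0"
    by (rule tendsto_le[OF trivial_limit_at_top_linorder lim lim' ev])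
  then show ?thesis
    by (simp add: W_zero W')
qed

end

theorem proposition1:
  fixes f :: "real^'d \<Rightarrow> real^'d"
    and g :: "real^'d \<Rightarrow> real^'m^'d"
    and l :: "real^'d \<Rightarrow> real"
    and R :: "real^'m^'m"
    and U :: "(real^'m) set"
    and \<Omega> :: "(real^'d) set"
    and V :: "real^'d \<Rightarrow> real"
    and u :: "nat \<Rightarrow> real^'d \<Rightarrow> real^'m"
    and W :: "nat \<Rightarrow> real^'d \<Rightarrow> real"
  assumes "open \<Omega>" "connected \<Omega>" "0 \<in> interior \<Omega>"
    and "closed U" "convex U" "0 \<in> U"
    and "sym_pos_def R"
    and "\<exists>L. L-lipschitz_on UNIV f" "f 0 = 0"
    and "\<exists>L. L-lipschitz_on UNIV g" "bounded (range g)"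
    and "\<exists>L. L-lipschitz_on UNIV l" "l 0 = 0" "\<And>y. y \<noteq> 0 \<Longrightarrow> 0 < l y"
    and V_value: "\<And>x. 0 \<le> V x \<and> ennreal (V x) = optimal_value f g l R U x"
    and V_attained: "\<And>x. x \<in> \<Omega> \<Longrightarrow> \<exists>v y. optimal_pair f g l R U x v y"
    and V_L2: "\<And>x. x \<in> \<Omega> \<Longrightarrow>
      \<exists>v y. control_pair f g U x v y \<and> square_integrable v \<and> sobolev_12 y"
    and V_C1: "C1 V"
    and V_unbounded: "filterlim V at_top at_infinity"
    and W_C1: "\<And>i. C1 (W i)"
    and W_eq: "\<And>i x. gradient (W i) x \<bullet> (f x + g x *v u i x) + l x + wnorm_sq R (u i x) = 0"
    and W_0: "\<And>i. W i 0 = 0"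
    and u_Suc: "\<And>i x. u (Suc i) x =
      wproj R U (- (1/2) *\<^sub>R (matrix_inv R *v (transpose (g x) *v gradient (W i) x)))"
    and u_0: "u 0 \<in> admissible f g l R U \<Omega>"
  shows "(\<forall>i. u i \<in> admissible f g l R U \<Omega>) \<and>
    (\<forall>i. \<forall>x\<in>\<Omega>. V x \<le> W (Suc i) x \<and> W (Suc i) x \<le> W i x) \<and>
    (\<exists>Vbar. \<forall>x\<in>\<Omega>. (\<lambda>i. W i x) \<longlonglongrightarrow> Vbar x \<and> (\<forall>i. Vbar x \<le> W i x) \<and> V x \<le> Vbar x)"
proof -
  interpret control_problem f g l R U \<Omega> V
  proof unfold_locales
    show "0 \<in> \<Omega>"
      using assms(3) interior_subset by blast
    show "continuous_on UNIV f" "continuous_on UNIV g" "continuous_on UNIV l"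
      using assms(8,10,12) lipschitz_on_continuous_on by auto
  qed (use assms in simp_all)
  have eq: "gradient (W i) x \<bullet> vector_field (u i) x = - running_cost (u i) x" for i x
    using W_eq[of i x] by (simp add: vector_field_def running_cost_def)
  have own: "dissipation (vector_field (u i)) (W i) (running_cost (u i))"
    if "u i \<in> admissible f g l R U \<Omega>" for i
    using feedback_dissipation[OF admissible_imp_feedback[OF that] W_C1 W_0] eq by simp
  have above: "V x \<le> W i x" if "u i \<in> admissible f g l R U \<Omega>" for i x
    by (rule value_le_policy_value[OF that own[OF that]])
  have improved: "u (Suc i) \<in> admissible f g l R U \<Omega> \<and>
      dissipation (vector_field (u (Suc i))) (W i) (running_cost (u (Suc i)))"
    if i: "u i \<in> admissible f g l R U \<Omega>" for i
  proof -
    have "0 \<le> W i x" for x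
      using V_value[of x] above[OF i, of x] by linarith
    then have fb: "feedback (u (Suc i))"
      using improved_policy_feedback[OF W_C1 W_0 _ u_Suc] by blast
    have "u i x \<in> U" for x
      using admissible_imp_feedback[OF i] by (simp add: feedback_def)
    then have "dissipation (vector_field (u (Suc i))) (W i) (running_cost (u (Suc i)))"
      by (intro feedback_dissipation fb W_C1 W_0 improved_policy_dissipates[OF _ W_eq u_Suc])
    then show ?thesis
      using coercive_dissipation_imp_admissible[OF fb _ above[OF i]] by blast
  qed
  have adm: "u i \<in> admissible f g l R U \<Omega>" for i
    by (induction i) (use u_0 improved in blast)+
  have mono: "W (Suc i) x \<le> W i x" if "x \<in> \<Omega>" for i x
    by (rule improved_policy_value_le[OF adm that _ W_C1 W_0 eq]) (use improved adm in blast)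
  have "\<exists>L. (\<lambda>i. W i x) \<longlonglongrightarrow> L \<and> (\<forall>i. L \<le> W i x) \<and> V x \<le> L" if x: "x \<in> \<Omega>" for x
  proof -
    have "decseq (\<lambda>i. W i x)"
      using mono[OF x] by (simp add: decseq_Suc_iff)
    then obtain L where L: "(\<lambda>i. W i x) \<longlonglongrightarrow> L" "\<forall>i. L \<le> W i x"
      using decseq_convergent[of "\<lambda>i. W i x" "V x"] above[OF adm] by blast
    moreover have "V x \<le> L"
      using L(1) above[OF adm] by (intro LIMSEQ_le_const) auto
    ultimately show ?thesis
      by blast
  qed
  then have "\<exists>Vbar. \<forall>x\<in>\<Omega>. (\<lambda>i. W i x) \<longlonglongrightarrow> Vbar x \<and> (\<forall>i. Vbar x \<le> W i x) \<and> V x \<le> Vbar x"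
    by (intro bchoice) blast
  then show ?thesis
    using adm above[OF adm] mono by blast
qed

end
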